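(* If $E$ is a right positive (admissible) $*$-tring, then $\mathcal{SN}_{cs}(E_0^r)=\mathcal{SN}(E_0^r)$, and $\mathcal{SN}(E)\cong\mathcal{SN}(E_0^r)$ and $\mathcal{N}(E)\cong\mathcal{N}(E_0^r)$ as ordered sets.
   Context: A $*$-ternary ring ($*$-tring) is a complex vector space $E$ with a map $(\cdot,\cdot,\cdot):E\times E\times E\to E$, linear in the first and third variables and conjugate linear in the second, such that $((x,y,z),u,v)=(x,(u,z,y),v)=(x,y,(z,u,v))$ for all $x,y,z,u,v\in E$. It is admissible if $(x,x,x)=0$ implies $x=0$. For an admissible $*$-tring $E$, $E_0^r=\mathrm{span}\{\langle y,z\rangle_r:y,z\in E\}$, where $\langle y,z\rangle_r:E\to E$ is $x\mapsto(x,y,z)$, is a $*$-algebra with product opposite to composition and involution determined by $\langle y,z\rangle_r^*=\langle z,y\rangle_r$; $E$ is a right $E_0^r$-module by evaluation. A $C^*$-seminorm on a $*$-tring $E$ is a seminorm $\gamma$ with $\gamma((x,y,z))\le\gamma(x)\gamma(y)\gamma(z)$ and $\gamma((x,x,x))=\gamma(x)^3$. A $C^*$-seminorm on a $*$-algebra is a submultiplicative seminorm $\alpha$ with $\alpha(a^*a)=\alpha(a)^2$. $\mathcal{SN}(\cdot)$ and $\mathcal{N}(\cdot)$ denote the sets of $C^*$-seminorms and $C^*$-norms, ordered pointwise. $\mathcal{SN}_{cs}(E_0^r)$ is the set of $\alpha\in\mathcal{SN}(E_0^r)$ with $\alpha(\langle x,y\rangle_r)^2\le\alpha(\langle x,x\rangle_r)\alpha(\langle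 y,y\rangle_r)$ for all $x,y\in E$. For a $*$-algebra $A$ and $\alpha\in\mathcal{SN}(A)$, $A_\alpha$ is the Hausdorff completion of $(A,\alpha)$ (a $C^*$-algebra) and $p_\alpha:A\to A_\alpha$ the canonical map. An element $a\in A$ is positive if $p_\alpha(a)$ is a positive element of $A_\alpha$ for every $\alpha\in\mathcal{SN}(A)$. An admissible $*$-tring $E$ is right positive if $\langle x,x\rangle_r$ is positive in $E_0^r$ for every $x\in E$. *)

theory Defs
  imports
    Complex_Main
    "HOL-Library.FuncSet"
    "HOL-Library.Function_Algebras"
    "HOL-Library.Nonpos_Ints"
begin

section \<open>Complex $*$-algebras and their $C^*$-seminorms\<close>

text \<open>
  The algebras need not be unital, and they are carried by subsets of types: both the algebra
  of right operators of a $*$-tring and the completions below depend on term parameters.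
\<close>

record 'a star_alg =
  alg_carrier :: "'a set"
  alg_zero :: 'a
  alg_add :: "'a \<Rightarrow> 'a \<Rightarrow> 'a"
  alg_scale :: "complex \<Rightarrow> 'a \<Rightarrow> 'a"
  alg_mult :: "'a \<Rightarrow> 'a \<Rightarrow> 'a"
  alg_star :: "'a \<Rightarrow> 'a"

definition alg_diff :: "'a star_alg \<Rightarrow> 'a \<Rightarrow> 'a \<Rightarrow> 'a" where
  "alg_diff A a b = alg_add A a (alg_scale A (- 1) b)"

text \<open>
  A seminorm is a function on the carrier, hence an element of \<open>extensional (alg_carrier A)\<close>.
  On such functions the order \<open>\<le>\<close> of the function type is the pointwise order on the carrier.
\<close>

definition alg_SN :: "'a star_alg \<Rightarrow> ('a \<Rightarrow> real) set" where
  "alg_SN A = {\<alpha> \<in> extensional (alg_carrier A).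
     (\<forall>a\<in>alg_carrier A. 0 \<le> \<alpha> a) \<and>
     (\<forall>a\<in>alg_carrier A. \<forall>b\<in>alg_carrier A. \<alpha> (alg_add A a b) \<le> \<alpha> a + \<alpha> b) \<and>
     (\<forall>c. \<forall>a\<in>alg_carrier A. \<alpha> (alg_scale A c a) = cmod c * \<alpha> a) \<and>
     (\<forall>a\<in>alg_carrier A. \<forall>b\<in>alg_carrier A. \<alpha> (alg_mult A a b) \<le> \<alpha> a * \<alpha> b) \<and>
     (\<forall>a\<in>alg_carrier A. \<alpha> (alg_mult A (alg_star A a) a) = (\<alpha> a)\<^sup>2)}"

definition alg_N :: "'a star_alg \<Rightarrow> ('a \<Rightarrow> real) set" where
  "alg_N A = {\<alpha> \<in> alg_SN A. \<forall>a\<in>alg_carrier A. \<alpha> a = 0 \<longrightarrow> a = alg_zero A}"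


section \<open>Positivity in a $C^*$-algebra\<close>

text \<open>
  The spectrum is taken in the unitization, whose element $a + s 1$ is the pair
  \<open>(a, s)\<close>.  If the algebra already has a unit, this changes the spectrum at most by the
  point $0$, which is irrelevant for positivity.
\<close>

definition unitization_mult ::
    "'a star_alg \<Rightarrow> 'a \<times> complex \<Rightarrow> 'a \<times> complex \<Rightarrow> 'a \<times> complex" where
  "unitization_mult A = (\<lambda>(a, s) (b, t).
     (alg_add A (alg_mult A a b) (alg_add A (alg_scale A t a) (alg_scale A s b)), s * t))"

definition alg_spectrum :: "'a star_alg \<Rightarrow> 'a \<Rightarrow> complex set" where
  "alg_spectrum A a = {s. \<not> (\<exists>b\<in>alg_carrier A. \<exists>t.
     unitization_mult A (a, - s) (b, t) = (alg_zero A, 1) \<and>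
     unitization_mult A (b, t) (a, - s) = (alg_zero A, 1))}"

definition cstar_positive :: "'a star_alg \<Rightarrow> 'a \<Rightarrow> bool" where
  "cstar_positive A a \<longleftrightarrow>
     a \<in> alg_carrier A \<and> alg_star A a = a \<and> alg_spectrum A a \<subseteq> \<real>\<^sub>\<ge>\<^sub>0"


section \<open>Hausdorff completion with respect to a $C^*$-seminorm\<close>

text \<open>
  Cauchy sequences modulo null sequences, with the operations induced by the termwise ones.
  The norm $[x] \mapsto \lim_n \alpha(x_n)$ is not recorded, as spectrum and positivity
  depend only on the $*$-algebra structure.
\<close>

definition cauchy_seqs :: "'a star_alg \<Rightarrow> ('a \<Rightarrow> real) \<Rightarrow> (nat \<Rightarrow> 'a) set" where
  "cauchy_seqs A \<alpha> = {x. (\<forall>n. x n \<in> alg_carrier A) \<and>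
     (\<forall>e>0. \<exists>N. \<forall>m\<ge>N. \<forall>n\<ge>N. \<alpha> (alg_diff A (x m) (x n)) < e)}"

definition null_rel :: "'a star_alg \<Rightarrow> ('a \<Rightarrow> real) \<Rightarrow> (nat \<Rightarrow> 'a) rel" where
  "null_rel A \<alpha> = {(x, y). x \<in> cauchy_seqs A \<alpha> \<and> y \<in> cauchy_seqs A \<alpha> \<and>
     (\<lambda>n. \<alpha> (alg_diff A (x n) (y n))) \<longlonglongrightarrow> 0}"

definition completion_class :: "'a star_alg \<Rightarrow> ('a \<Rightarrow> real) \<Rightarrow> (nat \<Rightarrow> 'a) \<Rightarrow> (nat \<Rightarrow> 'a) set" where
  "completion_class A \<alpha> x = null_rel A \<alpha> `` {x}"

definition hausdorff_completion :: "'a star_alg \<Rightarrow> ('a \<Rightarrow> real) \<Rightarrow> (nat \<Rightarrow> 'a) set star_alg" where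
  "hausdorff_completion A \<alpha> =
     \<lparr> alg_carrier = cauchy_seqs A \<alpha> // null_rel A \<alpha>,
       alg_zero = completion_class A \<alpha> (\<lambda>n. alg_zero A),
       alg_add = (\<lambda>X Y. \<Union>x\<in>X. \<Union>y\<in>Y. completion_class A \<alpha> (\<lambda>n. alg_add A (x n) (y n))),
       alg_scale = (\<lambda>c X. \<Union>x\<in>X. completion_class A \<alpha> (\<lambda>n. alg_scale A c (x n))),
       alg_mult = (\<lambda>X Y. \<Union>x\<in>X. \<Union>y\<in>Y. completion_class A \<alpha> (\<lambda>n. alg_mult A (x n) (y n))),
       alg_star = (\<lambda>X. \<Union>x\<in>X. completion_class A \<alpha> (\<lambda>n. alg_star A (x n))) \<rparr>"

definition completion_map :: "'a star_alg \<Rightarrow> ('a \<Rightarrow> real) \<Rightarrow> 'a \<Rightarrow> (nat \<Rightarrow> 'a) set" where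
  "completion_map A \<alpha> a = completion_class A \<alpha> (\<lambda>n. a)"

definition alg_positive :: "'a star_alg \<Rightarrow> 'a \<Rightarrow> bool" where
  "alg_positive A a \<longleftrightarrow> a \<in> alg_carrier A \<and>
     (\<forall>\<alpha>\<in>alg_SN A. cstar_positive (hausdorff_completion A \<alpha>) (completion_map A \<alpha> a))"


section \<open>$*$-ternary rings\<close>

locale star_tring = vector_space scale
  for scale :: "complex \<Rightarrow> 'e::ab_group_add \<Rightarrow> 'e" +
  fixes tp :: "'e \<Rightarrow> 'e \<Rightarrow> 'e \<Rightarrow> 'e"
  assumes linear_fst: "Vector_Spaces.linear scale scale (\<lambda>x. tp x y z)"
    and add_snd: "tp x (y + y') z = tp x y z + tp x y' z"
    and scale_snd: "tp x (scale c y) z = scale (cnj c) (tp x y z)"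
    and linear_trd: "Vector_Spaces.linear scale scale (\<lambda>z. tp x y z)"
    and assoc_mid: "tp (tp x y z) u v = tp x (tp u z y) v"
    and assoc_right: "tp (tp x y z) u v = tp x y (tp z u v)"

locale admissible_star_tring = star_tring scale tp
  for scale :: "complex \<Rightarrow> 'e::ab_group_add \<Rightarrow> 'e"
    and tp :: "'e \<Rightarrow> 'e \<Rightarrow> 'e \<Rightarrow> 'e" +
  assumes admissible: "tp x x x = 0 \<Longrightarrow> x = 0"

definition tring_SN ::
    "(complex \<Rightarrow> 'e::ab_group_add \<Rightarrow> 'e) \<Rightarrow> ('e \<Rightarrow> 'e \<Rightarrow> 'e \<Rightarrow> 'e) \<Rightarrow> ('e \<Rightarrow> real) set" where
  "tring_SN scale tp = {\<gamma>.
     (\<forall>x. 0 \<le> \<gamma> x) \<and>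
     (\<forall>x y. \<gamma> (x + y) \<le> \<gamma> x + \<gamma> y) \<and>
     (\<forall>c x. \<gamma> (scale c x) = cmod c * \<gamma> x) \<and>
     (\<forall>x y z. \<gamma> (tp x y z) \<le> \<gamma> x * \<gamma> y * \<gamma> z) \<and>
     (\<forall>x. \<gamma> (tp x x x) = \<gamma> x ^ 3)}"

definition tring_N ::
    "(complex \<Rightarrow> 'e::ab_group_add \<Rightarrow> 'e) \<Rightarrow> ('e \<Rightarrow> 'e \<Rightarrow> 'e \<Rightarrow> 'e) \<Rightarrow> ('e \<Rightarrow> real) set" where
  "tring_N scale tp = {\<gamma> \<in> tring_SN scale tp. \<forall>x. \<gamma> x = 0 \<longrightarrow> x = 0}"

definition r_inner :: "('e \<Rightarrow> 'e \<Rightarrow> 'e \<Rightarrow> 'e) \<Rightarrow> 'e \<Rightarrow> 'e \<Rightarrow> ('e \<Rightarrow> 'e)" where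
  "r_inner tp y z = (\<lambda>x. tp x y z)"

definition op_scale :: "(complex \<Rightarrow> 'e \<Rightarrow> 'e) \<Rightarrow> complex \<Rightarrow> ('e \<Rightarrow> 'e) \<Rightarrow> ('e \<Rightarrow> 'e)" where
  "op_scale scale c T = (\<lambda>x. scale c (T x))"

text \<open>
  The conjugate linear extension of $\langle y, z\rangle_r \mapsto \langle z, y\rangle_r$;
  \<open>admissible_star_tring.r_star_sum\<close> below shows that it does not depend on the
  representation of \<open>T\<close>.
\<close>

definition r_star ::
    "(complex \<Rightarrow> 'e::ab_group_add \<Rightarrow> 'e) \<Rightarrow> ('e \<Rightarrow> 'e \<Rightarrow> 'e \<Rightarrow> 'e) \<Rightarrow> ('e \<Rightarrow> 'e) \<Rightarrow> ('e \<Rightarrow> 'e)" where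
  "r_star scale tp T = (THE S. \<exists>(n::nat) c y z.
     T = (\<Sum>i<n. op_scale scale (c i) (r_inner tp (y i) (z i))) \<and>
     S = (\<Sum>i<n. op_scale scale (cnj (c i)) (r_inner tp (z i) (y i))))"

definition E0r ::
    "(complex \<Rightarrow> 'e::ab_group_add \<Rightarrow> 'e) \<Rightarrow> ('e \<Rightarrow> 'e \<Rightarrow> 'e \<Rightarrow> 'e) \<Rightarrow> ('e \<Rightarrow> 'e) star_alg" where
  "E0r scale tp =
     \<lparr> alg_carrier = module.span (op_scale scale) {r_inner tp y z | y z. True},
       alg_zero = 0,
       alg_add = (+),
       alg_scale = op_scale scale,
       alg_mult = (\<lambda>S T. T \<circ> S),
       alg_star = r_star scale tp \<rparr>"

definition E0r_SN_cs ::
    "(complex \<Rightarrow> 'e::ab_group_add \<Rightarrow> 'e) \<Rightarrow> ('e \<Rightarrow> 'e \<Rightarrow> 'e \<Rightarrow> 'e) \<Rightarrow> (('e \<Rightarrow> 'e) \<Rightarrow> real) set" where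
  "E0r_SN_cs scale tp = {\<alpha> \<in> alg_SN (E0r scale tp).
     \<forall>x y. (\<alpha> (r_inner tp x y))\<^sup>2 \<le> \<alpha> (r_inner tp x x) * \<alpha> (r_inner tp y y)}"

definition right_positive ::
    "(complex \<Rightarrow> 'e::ab_group_add \<Rightarrow> 'e) \<Rightarrow> ('e \<Rightarrow> 'e \<Rightarrow> 'e \<Rightarrow> 'e) \<Rightarrow> bool" where
  "right_positive scale tp \<longleftrightarrow> (\<forall>x. alg_positive (E0r scale tp) (r_inner tp x x))"

definition order_isomorphic :: "'a::order set \<Rightarrow> 'b::order set \<Rightarrow> bool" where
  "order_isomorphic X Y \<longleftrightarrow>
     (\<exists>f. bij_betw f X Y \<and> (\<forall>x\<in>X. \<forall>x'\<in>X. x \<le> x' \<longleftrightarrow> f x \<le> f x'))"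


context admissible_star_tring
begin

lemma sum_fun_apply: "(\<Sum>i\<in>I. g i) x = (\<Sum>i\<in>I. g i x)"
  for g :: "'i \<Rightarrow> 'b \<Rightarrow> 'c::comm_monoid_add"
  by (induction I rule: infinite_finite_induct) auto

lemma r_star_sum:
  fixes n :: nat
  shows "r_star scale tp (\<Sum>i<n. op_scale scale (c i) (r_inner tp (y i) (z i))) =
     (\<Sum>i<n. op_scale scale (cnj (c i)) (r_inner tp (z i) (y i)))"
proof -
  define opsum where
    "opsum m k u v = (\<Sum>i<m. op_scale scale (k i) (r_inner tp (u i) (v i)))"
    for m :: nat and k and u v :: "nat \<Rightarrow> 'e"
  have ev: "opsum m k u v x = (\<Sum>i<m. scale (k i) (tp x (u i) (v i)))" for m k u v x
    by (simp add: opsum_def sum_fun_apply op_scale_def r_inner_def)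
  have add1: "tp (a + b) u v = tp a u v + tp b u v"
    and sc1: "tp (scale k a) u v = scale k (tp a u v)" for a b u v k
    using linear_fst[of u v] by (auto simp: module_hom_iff_linear[symmetric] module_hom_def module_hom_axioms_def)
  have add3: "tp u v (a + b) = tp u v a + tp u v b"
    and sc3: "tp u v (scale k a) = scale k (tp u v a)" for a b u v k
    using linear_trd[of u v] by (auto simp: module_hom_iff_linear[symmetric] module_hom_def module_hom_axioms_def)
  have zero2: "tp u 0 v = 0" for u v
    using add_snd[of u 0 0 v] by simp
  have zero1: "tp 0 u v = 0" for u v
    using add1[of 0 0 u v] by simp
  have sum1: "tp (\<Sum>i<m. g i) u v = (\<Sum>i<m. tp (g i) u v)" for g u v and m :: nat
    by (induction m) (auto simp: zero1 add1)
  have sum2: "tp u (\<Sum>i<m. g i) v = (\<Sum>i<m. tp u (g i) v)" for g u v and m :: nat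
    by (induction m) (auto simp: zero2 add_snd)
  have adj: "tp u (opsum m (\<lambda>i. cnj (k i)) b a x) v = tp (opsum m k a b u) x v"
    for m k a b u v x
    unfolding ev by (simp add: sum1 sum2 scale_snd sc1 assoc_mid)
  have "opsum m (\<lambda>i. cnj (k i)) b a = opsum n (\<lambda>i. cnj (c i)) z y"
    if eq: "opsum n c y z = opsum m k a b" for m k a b
  proof
    fix x
    let ?p = "opsum m (\<lambda>i. cnj (k i)) b a x" and ?q = "opsum n (\<lambda>i. cnj (c i)) z y x"
    have same: "tp u ?p v = tp u ?q v" for u v
      by (simp add: adj eq)
    have "tp u ?p v = tp u (?p - ?q) v + tp u ?q v" for u v
      using add_snd[of u "?p - ?q" ?q v] by simp
    then have "tp u (?p - ?q) v = 0" for u v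
      using same by simp
    then show "?p = ?q"
      using admissible[of "?p - ?q"] by simp
  qed
  then show ?thesis
    unfolding r_star_def opsum_def by (intro the_equality) blast+
qed

end

end

theory Submission
  imports Defs
begin

text \<open>
  For $\alpha \in \mathcal{SN}(E_0^r)$ put $\gamma_\alpha(x) = \alpha(\langle x, x\rangle)^{1/2}$.
  The inverse map sends $\gamma$ to the operator seminorm of right multiplication on
  $(E, \gamma)$.

  Positivity enters through the Cauchy-Schwarz inequality.  With $a = \langle x, y\rangle$, the
  positive elements $u = \langle xa + y, xa + y\rangle$ and $v = \langle xa - y, xa - y\rangle$ satisfy
  $u - v = 4 a^* a$ and $u + v = 2 (a^* \langle x, x\rangle a + \langle y, y\rangle)$, and
  $\alpha(u - v) \le \alpha(u + v)$ holds for positive elements; scaling $x$ optimally gives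
  $\alpha(a)^2 \le \alpha(\langle x, x\rangle) \alpha(\langle y, y\rangle)$.
  The norm inequality is obtained without functional calculus: a self-adjoint operator $L$ with
  $\|L\| \le w$ for which $w^2 - L^2$ is bounded below has $\|L\| < w$, and positivity of $v$ is used
  only in the form that $v + \varepsilon$ is bounded below for every $\varepsilon > 0$.
\<close>

section \<open>Symmetric operators on a $C^*$-seminormed algebra\<close>

text \<open>The algebra need be neither unital nor complete, so inverses and square roots are not at
  hand in it. Scalars are therefore added to operators on A instead of elements of A, and
  invertibility is replaced by lower bounds for \<alpha>, which make sense on A itself. The
  completion is entered only to turn a statement about the spectrum into an approximate inverse in
  A. The operator seminorm shows that every \<gamma> arises from some \<alpha>. That
  \<gamma>_\<alpha> in turn determines \<alpha>, and its place in the order, is less direct: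
  \<gamma>_\<alpha> records \<alpha> on the elements <x, x> only, not on their linear combinations.
  Cauchy-Schwarz compares two C*-seminorms up to a constant depending on the element, and high
  powers of a self-adjoint element remove that constant.\<close>

locale star_algebra_on = vector_space scale
  for scale :: "complex \<Rightarrow> 'a::ab_group_add \<Rightarrow> 'a" (infixr \<open>*s\<close> 75) +
  fixes A :: "'a set"
    and mul :: "'a \<Rightarrow> 'a \<Rightarrow> 'a" (infixl \<open>\<odot>\<close> 70)
    and star :: "'a \<Rightarrow> 'a"
  assumes subspace_carrier: "subspace A"
    and mul_closed [simp]: "x \<in> A \<Longrightarrow> y \<in> A \<Longrightarrow> x \<odot> y \<in> A"
    and mul_assoc: "x \<in> A \<Longrightarrow> y \<in> A \<Longrightarrow> z \<in> A \<Longrightarrow> (x \<odot> y) \<odot> z = x \<odot> (y \<odot> z)"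
    and mul_add_left: "x \<in> A \<Longrightarrow> y \<in> A \<Longrightarrow> z \<in> A \<Longrightarrow> (x + y) \<odot> z = x \<odot> z + y \<odot> z"
    and mul_add_right: "x \<in> A \<Longrightarrow> y \<in> A \<Longrightarrow> z \<in> A \<Longrightarrow> x \<odot> (y + z) = x \<odot> y + x \<odot> z"
    and mul_scale_left: "x \<in> A \<Longrightarrow> y \<in> A \<Longrightarrow> (c *s x) \<odot> y = c *s (x \<odot> y)"
    and mul_scale_right: "x \<in> A \<Longrightarrow> y \<in> A \<Longrightarrow> x \<odot> (c *s y) = c *s (x \<odot> y)"
    and star_closed [simp]: "x \<in> A \<Longrightarrow> star x \<in> A"
    and star_star: "x \<in> A \<Longrightarrow> star (star x) = x"
    and star_add: "x \<in> A \<Longrightarrow> y \<in> A \<Longrightarrow> star (x + y) = star x + star y"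
    and star_scale: "x \<in> A \<Longrightarrow> star (c *s x) = cnj c *s star x"
    and star_mul: "x \<in> A \<Longrightarrow> y \<in> A \<Longrightarrow> star (x \<odot> y) = star y \<odot> star x"
begin

definition alg :: "'a star_alg" where
  "alg = \<lparr> alg_carrier = A, alg_zero = 0, alg_add = (+), alg_scale = scale,
     alg_mult = (\<odot>), alg_star = star \<rparr>"

lemma closed [simp]:
  "0 \<in> A"
  "x \<in> A \<Longrightarrow> y \<in> A \<Longrightarrow> x + y \<in> A"
  "x \<in> A \<Longrightarrow> y \<in> A \<Longrightarrow> x - y \<in> A"
  "x \<in> A \<Longrightarrow> - x \<in> A"
  "x \<in> A \<Longrightarrow> c *s x \<in> A"
  using subspace_carrier
  by (auto intro: subspace_0 subspace_add subspace_diff subspace_neg subspace_scale)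

lemma mul_diff_left: "x \<in> A \<Longrightarrow> y \<in> A \<Longrightarrow> z \<in> A \<Longrightarrow> (x - y) \<odot> z = x \<odot> z - y \<odot> z"
  using mul_add_left[of x "(- 1) *s y" z] mul_scale_left[of y z "- 1"] by simp

lemma mul_diff_right: "x \<in> A \<Longrightarrow> y \<in> A \<Longrightarrow> z \<in> A \<Longrightarrow> x \<odot> (y - z) = x \<odot> y - x \<odot> z"
  using mul_add_right[of x y "(- 1) *s z"] mul_scale_right[of x z "- 1"] by simp

lemma star_diff: "x \<in> A \<Longrightarrow> y \<in> A \<Longrightarrow> star (x - y) = star x - star y"
  using star_add[of x "(- 1) *s y"] star_scale[of y "- 1"] by simp

text \<open>These are the self-adjoint operators for the A-valued form
  \<open>star x \<odot> y\<close>. Multiplication by c + d V, with c and d real and V self-adjoint,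
  is one of them, although c + d V is in general no element of A.\<close>

definition symmetric_op :: "('a \<Rightarrow> 'a) \<Rightarrow> bool" where
  "symmetric_op L \<longleftrightarrow>
     (\<forall>x\<in>A. L x \<in> A) \<and>
     (\<forall>x\<in>A. \<forall>y\<in>A. L (x + y) = L x + L y) \<and>
     (\<forall>c. \<forall>x\<in>A. L (c *s x) = c *s L x) \<and>
     (\<forall>x\<in>A. \<forall>y\<in>A. star (L x) \<odot> y = star x \<odot> L y)"

lemma symmetric_opD:
  assumes "symmetric_op L"
  shows symmetric_op_closed: "x \<in> A \<Longrightarrow> L x \<in> A"
    and symmetric_op_add: "x \<in> A \<Longrightarrow> y \<in> A \<Longrightarrow> L (x + y) = L x + L y"
    and symmetric_op_scale: "x \<in> A \<Longrightarrow> L (c *s x) = c *s L x"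
    and symmetric_op_star: "x \<in> A \<Longrightarrow> y \<in> A \<Longrightarrow> star (L x) \<odot> y = star x \<odot> L y"
  using assms by (auto simp: symmetric_op_def)

lemma symmetric_op_diff:
  assumes "symmetric_op L" "x \<in> A" "y \<in> A"
  shows "L (x - y) = L x - L y"
  using symmetric_op_add[OF assms(1,2), of "(- 1) *s y"] symmetric_op_scale[OF assms(1,3), of "- 1"]
    assms(3) by simp

lemma symmetric_op_funpow:
  assumes "symmetric_op L"
  shows "symmetric_op (L ^^ n)"
proof (induction n)
  case 0
  show ?case by (simp add: symmetric_op_def)
next
  case (Suc n)
  note D = symmetric_opD[OF Suc] symmetric_opD[OF assms]
  have comm: "(L ^^ n) (L y) = L ((L ^^ n) y)" for y
    by (simp add: funpow_swap1)
  show ?case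
    unfolding symmetric_op_def by (auto simp: D comm)
qed

lemma symmetric_op_scaled:
  assumes "symmetric_op L"
  shows "symmetric_op (\<lambda>x. of_real r *s L x)"
  using symmetric_opD[OF assms] unfolding symmetric_op_def
  by (simp add: scale_right_distrib mult.commute star_scale mul_scale_left mul_scale_right)

lemma symmetric_op_affine:
  assumes "V \<in> A" "star V = V"
  shows "symmetric_op (\<lambda>x. of_real c *s x + of_real d *s (V \<odot> x))"
  unfolding symmetric_op_def using assms
  by (simp add: algebra_simps scale_right_distrib mul_add_left mul_add_right star_add star_scale
      star_mul mul_scale_left mul_scale_right mul_assoc)

end

section \<open>C*-seminorms and estimates for symmetric operators\<close>

locale cstar_seminormed = star_algebra_on +
  fixes \<alpha> :: "'a \<Rightarrow> real"
  assumes SN: "\<alpha> \<in> alg_SN alg"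
begin

lemma nonneg [simp]: "x \<in> A \<Longrightarrow> 0 \<le> \<alpha> x"
  and triangle: "x \<in> A \<Longrightarrow> y \<in> A \<Longrightarrow> \<alpha> (x + y) \<le> \<alpha> x + \<alpha> y"
  and homogeneous: "x \<in> A \<Longrightarrow> \<alpha> (c *s x) = cmod c * \<alpha> x"
  and submult: "x \<in> A \<Longrightarrow> y \<in> A \<Longrightarrow> \<alpha> (x \<odot> y) \<le> \<alpha> x * \<alpha> y"
  and cstar: "x \<in> A \<Longrightarrow> \<alpha> (star x \<odot> x) = (\<alpha> x)\<^sup>2"
  using SN by (auto simp: alg_SN_def alg_def)

lemma zero [simp]: "\<alpha> 0 = 0"
  using homogeneous[of 0 0] by simp

lemma minus [simp]: "x \<in> A \<Longrightarrow> \<alpha> (- x) = \<alpha> x"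
  using homogeneous[of x "- 1"] by simp

lemma triangle_diff: "x \<in> A \<Longrightarrow> y \<in> A \<Longrightarrow> \<alpha> (x - y) \<le> \<alpha> x + \<alpha> y"
  using triangle[of x "- y"] by simp

lemma reverse_triangle: "x \<in> A \<Longrightarrow> y \<in> A \<Longrightarrow> \<alpha> x - \<alpha> y \<le> \<alpha> (x - y)"
  using triangle[of "x - y" y] by simp

lemma star_isometric:
  assumes "x \<in> A"
  shows "\<alpha> (star x) = \<alpha> x"
proof -
  have le: "\<alpha> y \<le> \<alpha> (star y)" if "y \<in> A" for y
  proof (cases "\<alpha> y = 0")
    case False
    have "\<alpha> y * \<alpha> y \<le> \<alpha> (star y) * \<alpha> y"
      using submult[of "star y" y] cstar[OF that] that by (simp add: power2_eq_square)
    with False nonneg[OF that] show ?thesis by simp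
  qed (use that in simp)
  show ?thesis
    using le[OF assms] le[of "star x"] assms by (simp add: star_star)
qed

lemma selfadjoint_power:
  assumes "h \<in> A" "star h = h"
  shows "\<alpha> (h \<odot> h) = (\<alpha> h)\<^sup>2"
  using cstar[OF assms(1)] assms(2) by simp

text \<open>Cauchy-Schwarz for the form \<open>star x \<odot> y\<close>, after moving one L across;
  it makes \<alpha>(L^n x) log-convex in n.\<close>

lemma symmetric_op_square:
  assumes "symmetric_op L" "x \<in> A"
  shows "(\<alpha> (L x))\<^sup>2 \<le> \<alpha> x * \<alpha> (L (L x))"
proof -
  note D = symmetric_opD[OF assms(1)]
  have "(\<alpha> (L x))\<^sup>2 = \<alpha> (star x \<odot> L (L x))"
    using cstar[of "L x"] D(4)[of x "L x"] assms(2) by (simp add: D)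
  also have "\<dots> \<le> \<alpha> (star x) * \<alpha> (L (L x))"
    using assms(2) by (intro submult) (auto simp: D)
  finally show ?thesis
    using assms(2) by (simp add: star_isometric)
qed

text \<open>Repeated doubling: the bound for 2^j is squared, and \<open>symmetric_op_square\<close>
  is applied to L^(2^j). In this way the smallness of one high power of L comes back to L.\<close>

lemma symmetric_op_power:
  assumes "symmetric_op L" "x \<in> A"
  shows "\<alpha> (L x) ^ 2 ^ j \<le> \<alpha> x ^ (2 ^ j - 1) * \<alpha> ((L ^^ 2 ^ j) x)"
proof (induction j)
  case (Suc j)
  let ?M = "L ^^ 2 ^ j"
  note M = symmetric_op_funpow[OF assms(1), of "2 ^ j"]
  have MM: "?M (?M x) = (L ^^ 2 ^ Suc j) x"
    by (simp add: mult_2 funpow_add)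
  have "\<alpha> (L x) ^ 2 ^ Suc j = (\<alpha> (L x) ^ 2 ^ j)\<^sup>2"
    by (simp add: power_mult[symmetric] mult.commute)
  also have "\<dots> \<le> (\<alpha> x ^ (2 ^ j - 1) * \<alpha> (?M x))\<^sup>2"
    using Suc by (rule power_mono) (use assms in \<open>simp add: symmetric_op_closed[OF assms(1)]\<close>)
  also have "\<dots> = \<alpha> x ^ (2 * (2 ^ j - 1)) * (\<alpha> (?M x))\<^sup>2"
    by (simp add: power_mult_distrib power_mult[symmetric] mult.commute)
  also have "\<dots> \<le> \<alpha> x ^ (2 * (2 ^ j - 1)) * (\<alpha> x * \<alpha> (?M (?M x)))"
    using symmetric_op_square[OF M assms(2)] assms(2) by (intro mult_left_mono) auto
  also have "\<dots> = \<alpha> x ^ Suc (2 * (2 ^ j - 1)) * \<alpha> ((L ^^ 2 ^ Suc j) x)"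
    by (simp only: MM power_Suc mult_ac)
  also have "Suc (2 * (2 ^ j - 1)) = 2 ^ Suc j - (1::nat)"
  proof -
    have "1 \<le> (2::nat) ^ j" by simp
    then show ?thesis unfolding power_Suc by linarith
  qed
  finally show ?case .
qed simp

text \<open>By symmetry of L the cross terms cancel in both squares, so the C*-identity gives the
  same value. This is the isometry of the Cayley transform of L.\<close>

lemma symmetric_op_cayley:
  assumes "symmetric_op L" "x \<in> A"
  shows "\<alpha> (x + \<i> *s L x) = \<alpha> (x - \<i> *s L x)"
proof -
  note D = symmetric_opD[OF assms(1)]
  have "star (x + \<i> *s L x) \<odot> (x + \<i> *s L x) = star (x - \<i> *s L x) \<odot> (x - \<i> *s L x)"
    using assms(2)
    by (simp add: D star_add star_diff star_scale mul_add_left mul_add_right mul_diff_left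
        mul_diff_right mul_scale_left mul_scale_right scale_right_distrib scale_right_diff_distrib)
  then have "(\<alpha> (x + \<i> *s L x))\<^sup>2 = (\<alpha> (x - \<i> *s L x))\<^sup>2"
    using cstar[of "x + \<i> *s L x"] cstar[of "x - \<i> *s L x"] assms(2) by (simp add: D)
  then show ?thesis
    using assms(2) by (simp add: D power2_eq_iff_nonneg)
qed

text \<open>Operator form of $1 + t^2 \ge 2 |t|$, from $1 + t^2 = |(1 \pm i t)^2|$ and
  $(1 + i t)^2 - (1 - i t)^2 = 4 i t$.\<close>

lemma symmetric_op_amgm:
  assumes "symmetric_op L" "x \<in> A"
  shows "2 * \<alpha> (L x) \<le> \<alpha> (x + L (L x))"
proof -
  note D = symmetric_opD[OF assms(1)] symmetric_op_diff[OF assms(1)]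
  let ?p = "x - L (L x) + (\<i> *s L x + \<i> *s L x)"
    and ?q = "x - L (L x) - (\<i> *s L x + \<i> *s L x)"
  have "\<alpha> (x + L (L x)) = \<alpha> ?p"
    using symmetric_op_cayley[OF assms(1), of "x + \<i> *s L x"] assms(2)
    by (simp add: D scale_right_distrib algebra_simps)
  moreover have "\<alpha> (x + L (L x)) = \<alpha> ?q"
    using symmetric_op_cayley[OF assms(1), of "x - \<i> *s L x"] assms(2)
    by (simp add: D scale_right_distrib scale_right_diff_distrib algebra_simps)
  moreover have "\<alpha> (?p - ?q) = 4 * \<alpha> (L x)"
  proof -
    have "?p - ?q = (4 * \<i>) *s L x"
      by (simp add: scale_left_distrib[symmetric])
    then show ?thesis
      using assms(2) by (simp add: homogeneous D norm_mult del: add_diff_eq diff_diff_eq2)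
  qed
  moreover have "\<alpha> (?p - ?q) \<le> \<alpha> ?p + \<alpha> ?q"
    using assms(2) by (intro triangle_diff) (auto simp: D)
  ultimately show ?thesis by simp
qed

text \<open>The witness is $(1 + L^2)(1 + L^4) \cdots (1 + L^{2^j}) x = \sum_{k < 2^j} L^{2k} x$.\<close>

lemma geometric_sum_lower_bound:
  assumes "symmetric_op L" "x \<in> A"
  shows "\<exists>y\<in>A. y - L (L y) = x - (L ^^ 2 ^ Suc j) x \<and> 2 ^ j * \<alpha> ((L ^^ (2 ^ j - 1)) x) \<le> \<alpha> y"
  using assms(2)
proof (induction j arbitrary: x)
  case 0
  then show ?case by (intro bexI[of _ x]) (auto simp: numeral_2_eq_2)
next
  case (Suc j)
  let ?M = "L ^^ 2 ^ j" and ?N = "L ^^ (2 ^ j - 1)"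
  note M = symmetric_op_funpow[OF assms(1), of "2 ^ j"]
  note N = symmetric_op_funpow[OF assms(1), of "2 ^ j - 1"]
  have comp: "(L ^^ a) ((L ^^ b) z) = (L ^^ (a + b)) z" for a b z
    by (simp add: funpow_add)
  \<comment> \<open>With this argument the right-hand side telescopes, and
    \<open>symmetric_op_amgm\<close> for L^(2^j) doubles the lower bound. The exponent 2^j - 1 is
    the mean of the exponents 0, 2, ..., 2^(j+1) - 2 of the sum, as in the inequality of arithmetic
    and geometric means.\<close>
  let ?x = "x + ?M (?M x)"
  have x': "?x \<in> A"
    using Suc.prems by (simp add: symmetric_op_closed[OF M])
  obtain y where y: "y \<in> A" "y - L (L y) = ?x - (L ^^ 2 ^ Suc j) ?x" "2 ^ j * \<alpha> (?N ?x) \<le> \<alpha> y"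
    using Suc.IH[OF x'] by blast
  have "(L ^^ 2 ^ Suc j) ?x = (L ^^ 2 ^ Suc j) x + (L ^^ 2 ^ Suc (Suc j)) x"
    using Suc.prems symmetric_op_funpow[OF assms(1)]
    by (simp add: symmetric_op_add symmetric_op_closed comp mult_2)
  then have "y - L (L y) = x - (L ^^ 2 ^ Suc (Suc j)) x"
    using y(2) by (simp add: comp mult_2)
  moreover have "2 ^ Suc j * \<alpha> ((L ^^ (2 ^ Suc j - 1)) x) \<le> \<alpha> y"
  proof -
    have "?M (?N x) = (L ^^ (2 ^ Suc j - 1)) x"
      by (simp add: comp mult_2)
    moreover have "?M (?M (?N x)) = ?N (?M (?M x))"
      by (simp only: comp add_ac)
    then have "?N x + ?M (?M (?N x)) = ?N ?x"
      using symmetric_op_add[OF N Suc.prems symmetric_op_closed[OF M symmetric_op_closed[OF M Suc.prems]]]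
      by (simp only:)
    ultimately have "2 * \<alpha> ((L ^^ (2 ^ Suc j - 1)) x) \<le> \<alpha> (?N ?x)"
      using symmetric_op_amgm[OF M, of "?N x"] symmetric_op_closed[OF N Suc.prems] by simp
    then have "2 ^ j * (2 * \<alpha> ((L ^^ (2 ^ Suc j - 1)) x)) \<le> 2 ^ j * \<alpha> (?N ?x)"
      by (intro mult_left_mono) auto
    also note y(3)
    finally show ?thesis by (simp only: power_Suc mult_ac)
  qed
  ultimately show ?case using y(1) by blast
qed

text \<open>Let y be the geometric sum of x. By telescoping, (1 - L^2) y has size at most 2
  \<alpha>(x), whereas \<alpha>(y) dominates 2^j \<alpha>(L^(2^j - 1) x). The gap thus makes a high
  power of L small, and \<open>symmetric_op_power\<close> carries this back to L.\<close>

lemma strict_contraction_normalized: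
  assumes L: "symmetric_op L"
    and contr: "\<And>x. x \<in> A \<Longrightarrow> \<alpha> (L x) \<le> \<alpha> x"
    and \<kappa>: "0 < \<kappa>" and gap: "\<And>x. x \<in> A \<Longrightarrow> \<kappa> * \<alpha> x \<le> \<alpha> (x - L (L x))"
  shows "\<exists>\<theta><1. \<forall>x\<in>A. \<alpha> (L x) \<le> \<theta> * \<alpha> x"
proof -
  \<comment> \<open>Once \<kappa> 2^j > 4, the estimate \<kappa> 2^j \<alpha>(L^(2^j - 1) x) \<le> 2
    \<alpha>(x) yields the factor 1/2.\<close>
  obtain j where j: "4 / \<kappa> < 2 ^ j"
    using real_arch_pow[of 2 "4 / \<kappa>"] by auto
  have contr_pow: "\<alpha> ((L ^^ n) x) \<le> \<alpha> x" if "x \<in> A" for n x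
  proof (induction n)
    case (Suc n)
    then show ?case
      using contr[of "(L ^^ n) x"] symmetric_op_closed[OF symmetric_op_funpow[OF L] that] by fastforce
  qed simp
  have half: "\<alpha> ((L ^^ (2 ^ j - 1)) x) \<le> \<alpha> x / 2" if x: "x \<in> A" for x
  proof -
    obtain y where y: "y \<in> A" "y - L (L y) = x - (L ^^ 2 ^ Suc j) x"
        "2 ^ j * \<alpha> ((L ^^ (2 ^ j - 1)) x) \<le> \<alpha> y"
      using geometric_sum_lower_bound[OF L x] by blast
    have "\<kappa> * \<alpha> y \<le> \<alpha> (x - (L ^^ 2 ^ Suc j) x)"
      using gap[OF y(1)] y(2) by simp
    also have "\<dots> \<le> 2 * \<alpha> x"
      using triangle_diff[OF x, of "(L ^^ 2 ^ Suc j) x"] contr_pow[OF x, of "2 ^ Suc j"]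
        symmetric_op_closed[OF symmetric_op_funpow[OF L] x] by simp
    finally have "\<kappa> * (2 ^ j * \<alpha> ((L ^^ (2 ^ j - 1)) x)) \<le> 2 * \<alpha> x"
      using mult_left_mono[OF y(3), of \<kappa>] \<kappa> by linarith
    moreover have "4 * \<alpha> ((L ^^ (2 ^ j - 1)) x) \<le> (\<kappa> * 2 ^ j) * \<alpha> ((L ^^ (2 ^ j - 1)) x)"
      using j \<kappa> symmetric_op_closed[OF symmetric_op_funpow[OF L] x]
      by (intro mult_right_mono) (auto simp: field_simps)
    ultimately show ?thesis by (simp add: mult.assoc)
  qed
  define \<theta> where "\<theta> = root (2 ^ j) (1 / 2)"
  have \<theta>: "0 \<le> \<theta>" "\<theta> < 1" "\<theta> ^ 2 ^ j = 1 / 2"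
    by (auto simp: \<theta>_def)
  have "\<alpha> (L x) \<le> \<theta> * \<alpha> x" if x: "x \<in> A" for x
  proof -
    have Lx: "L x \<in> A" using symmetric_op_closed[OF L x] .
    have "(L ^^ 2 ^ j) x = (L ^^ (2 ^ j - 1)) (L x)"
      by (metis Suc_diff_1 comp_apply funpow_Suc_right pos2 zero_less_power)
    then have "\<alpha> ((L ^^ 2 ^ j) x) \<le> \<alpha> x / 2"
      using half[OF Lx] contr[OF x] by simp
    then have "\<alpha> (L x) ^ 2 ^ j \<le> \<alpha> x ^ (2 ^ j - 1) * (\<alpha> x / 2)"
      using symmetric_op_power[OF L x, of j] x
      by (meson mult_left_mono nonneg order_trans zero_le_power)
    also have "\<dots> = (\<alpha> x ^ (2 ^ j - 1) * \<alpha> x) / 2"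
      by simp
    also have "\<dots> = (\<theta> * \<alpha> x) ^ 2 ^ j"
      using \<theta>(3) by (subst power_minus_mult) (auto simp: power_mult_distrib)
    finally show ?thesis
      using \<theta>(1) x Lx by (subst (asm) power_mono_iff) auto
  qed
  with \<theta>(2) show ?thesis by blast
qed

text \<open>Stands in for the fact that the spectrum of a self-adjoint operator of norm $w$
  contains $w$ or $-w$.\<close>

lemma strict_contraction:
  assumes L: "symmetric_op L" and w: "0 < w"
    and bound: "\<And>x. x \<in> A \<Longrightarrow> \<alpha> (L x) \<le> w * \<alpha> x"
    and \<kappa>: "0 < \<kappa>"
    and gap: "\<And>x. x \<in> A \<Longrightarrow> \<kappa> * \<alpha> x \<le> \<alpha> (of_real (w\<^sup>2) *s x - L (L x))"
  shows "\<exists>\<theta><w. \<forall>x\<in>A. \<alpha> (L x) \<le> \<theta> * \<alpha> x"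
proof -
  let ?L = "\<lambda>x. of_real (1 / w) *s L x"
  note closed_L = symmetric_op_closed[OF L]
  have norm: "\<alpha> (?L x) = \<alpha> (L x) / w" if "x \<in> A" for x
    using that w by (simp add: homogeneous closed_L norm_divide)
  have "\<exists>\<theta><1. \<forall>x\<in>A. \<alpha> (?L x) \<le> \<theta> * \<alpha> x"
  proof (rule strict_contraction_normalized[OF symmetric_op_scaled[OF L]])
    show "\<alpha> (?L x) \<le> \<alpha> x" if "x \<in> A" for x
      using bound[OF that] w unfolding norm[OF that] by (simp add: field_simps)
    show "0 < \<kappa> / w\<^sup>2" using \<kappa> w by simp
    show "\<kappa> / w\<^sup>2 * \<alpha> x \<le> \<alpha> (x - ?L (?L x))" if x: "x \<in> A" for x
    proof -
      have "x - ?L (?L x) = of_real (1 / w\<^sup>2) *s (of_real (w\<^sup>2) *s x - L (L x))"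
        using w x by (simp add: symmetric_op_scale[OF L] closed_L scale_right_diff_distrib power2_eq_square)
      then have "\<alpha> (x - ?L (?L x)) = \<alpha> (of_real (w\<^sup>2) *s x - L (L x)) / w\<^sup>2"
        using x by (simp add: homogeneous closed_L norm_divide norm_power)
      then show ?thesis
        using gap[OF x] w by (simp add: field_simps)
    qed
  qed
  then obtain \<theta> where "\<theta> < 1" and \<theta>: "\<And>x. x \<in> A \<Longrightarrow> \<alpha> (?L x) \<le> \<theta> * \<alpha> x"
    by blast
  have "\<alpha> (L x) \<le> \<theta> * w * \<alpha> x" if "x \<in> A" for x
    using w \<theta>[OF that] unfolding norm[OF that] by (simp add: field_simps)
  then show ?thesis
    using w \<open>\<theta> < 1\<close> by (intro exI[of _ "\<theta> * w"]) auto
qed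

section \<open>Positive elements\<close>

text \<open>The condition keeps each -\<epsilon> out of the approximate point spectrum of
  multiplication by V. No dependence of \<kappa> on \<epsilon> is prescribed; \<kappa> = \<epsilon>
  is recovered in \<open>bounded_below_shifts_lower_bound\<close>.\<close>

definition bounded_below_shifts :: "'a \<Rightarrow> bool" where
  "bounded_below_shifts V \<longleftrightarrow> V \<in> A \<and> star V = V \<and>
     (\<forall>\<epsilon>>0. \<exists>\<kappa>>0. \<forall>x\<in>A. \<kappa> * \<alpha> x \<le> \<alpha> (V \<odot> x + of_real \<epsilon> *s x))"

text \<open>Suppose the operator seminorm w of L = s - V exceeded s. In w^2 - L^2 = (w - L)(w + L)
  the factor w - L = V + (w - s) is bounded below by hypothesis, and w + L = (w + s) - V by the
  triangle inequality, so \<open>strict_contraction\<close> would push the seminorm below w.\<close>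

lemma bounded_below_shifts_norm:
  assumes V: "bounded_below_shifts V" and s: "\<alpha> V \<le> s" and x: "x \<in> A"
  shows "\<alpha> (of_real s *s x - V \<odot> x) \<le> s * \<alpha> x"
proof -
  have VA: "V \<in> A" and V_star: "star V = V"
    using V by (auto simp: bounded_below_shifts_def)
  have s0: "0 \<le> s" using s nonneg[OF VA] by linarith
  define L where "L = (\<lambda>x. of_real s *s x - V \<odot> x)"
  have L: "symmetric_op L"
    using symmetric_op_affine[OF VA V_star, of s "- 1"] by (simp add: L_def)
  note closed_L = symmetric_op_closed[OF L]
  have V_bound: "\<alpha> (V \<odot> x) \<le> s * \<alpha> x" if "x \<in> A" for x
    using submult[OF VA that] mult_right_mono[OF s nonneg[OF that]] by linarith
  define W where "W = {c. 0 \<le> c \<and> (\<forall>x\<in>A. \<alpha> (L x) \<le> c * \<alpha> x)}"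
  define w where "w = Inf W"
  have "2 * s \<in> W"
    unfolding W_def
  proof (safe)
    fix x assume x: "x \<in> A"
    have "\<alpha> (L x) \<le> \<alpha> (of_real s *s x) + \<alpha> (V \<odot> x)"
      using x VA unfolding L_def by (intro triangle_diff) auto
    then show "\<alpha> (L x) \<le> 2 * s * \<alpha> x"
      using V_bound[OF x] s0 x by (simp add: homogeneous)
  qed (use s0 in simp)
  have bdd: "bdd_below W" by (rule bdd_belowI[of _ 0]) (auto simp: W_def)
  have bound: "\<alpha> (L x) \<le> w * \<alpha> x" if x: "x \<in> A" for x
  proof (cases "\<alpha> x = 0")
    case True
    with \<open>2 * s \<in> W\<close> x show ?thesis unfolding W_def by fastforce
  next
    case False
    then have pos: "0 < \<alpha> x" using nonneg[OF x] by linarith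
    have "\<alpha> (L x) / \<alpha> x \<le> w"
      unfolding w_def
    proof (rule cInf_greatest)
      show "W \<noteq> {}" using \<open>2 * s \<in> W\<close> by blast
    qed (use pos x in \<open>auto simp: W_def field_simps\<close>)
    with pos show ?thesis by (simp add: field_simps)
  qed
  have "w \<le> s"
  proof (rule ccontr)
    assume "\<not> w \<le> s"
    then have ws: "s < w" and w0: "0 < w" using s0 by auto
    obtain \<kappa> where \<kappa>: "0 < \<kappa>" "\<And>x. x \<in> A \<Longrightarrow> \<kappa> * \<alpha> x \<le> \<alpha> (V \<odot> x + of_real (w - s) *s x)"
      using V ws unfolding bounded_below_shifts_def by (metis diff_gt_0_iff_gt)
    have "\<kappa> * w * \<alpha> x \<le> \<alpha> (of_real (w\<^sup>2) *s x - L (L x))" if x: "x \<in> A" for x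
    proof -
      define z where "z = of_real w *s x + L x"
      have z: "z \<in> A" using x by (simp add: z_def closed_L)
      have "z = of_real (w + s) *s x - V \<odot> x"
        by (simp add: z_def L_def scale_left_distrib)
      then have "\<alpha> (of_real (w + s) *s x) - \<alpha> (V \<odot> x) \<le> \<alpha> z"
        using reverse_triangle[of "of_real (w + s) *s x" "V \<odot> x"] x VA by simp
      moreover have "\<alpha> (of_real (w + s) *s x) = (w + s) * \<alpha> x"
        using x s0 w0 by (simp add: homogeneous del: of_real_add)
      ultimately have "w * \<alpha> x \<le> \<alpha> z"
        using V_bound[OF x] by (simp add: algebra_simps)
      then have "\<kappa> * (w * \<alpha> x) \<le> \<kappa> * \<alpha> z"
        using \<kappa>(1) by simp
      also have "\<dots> \<le> \<alpha> (V \<odot> z + of_real (w - s) *s z)"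
        using \<kappa>(2)[OF z] .
      also have "V \<odot> z + of_real (w - s) *s z = of_real w *s z - L z"
        by (simp add: L_def scale_left_diff_distrib)
      also have "\<dots> = of_real (w\<^sup>2) *s x - L (L x)"
        using x by (simp add: z_def symmetric_op_add[OF L] symmetric_op_scale[OF L] closed_L
            scale_right_distrib power2_eq_square)
      finally show ?thesis by simp
    qed
    then obtain \<theta> where \<theta>: "\<theta> < w" "\<And>x. x \<in> A \<Longrightarrow> \<alpha> (L x) \<le> \<theta> * \<alpha> x"
      using strict_contraction[OF L w0 bound, of "\<kappa> * w"] \<kappa>(1) w0 by auto
    \<comment> \<open>\<theta> may be negative, while W holds nonnegative bounds; as 0 < w, the
      maximum is still below w.\<close>
    have "max \<theta> 0 \<in> W"
      unfolding W_def
    proof safe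
      fix x assume "x \<in> A"
      then show "\<alpha> (L x) \<le> max \<theta> 0 * \<alpha> x"
        using \<theta>(2)[of x] mult_right_mono[of \<theta> "max \<theta> 0" "\<alpha> x"] by fastforce
    qed simp
    then have "w \<le> max \<theta> 0"
      unfolding w_def using bdd by (intro cInf_lower)
    with \<theta>(1) w0 show False by simp
  qed
  then show ?thesis
    using bound[OF x] mult_right_mono[OF \<open>w \<le> s\<close> nonneg[OF x]] by (simp add: L_def)
qed

text \<open>V + p = (s + p) - (s - V) with s = \<alpha> V, and the subtracted operator costs at most
  s.\<close>

lemma bounded_below_shifts_lower_bound:
  assumes V: "bounded_below_shifts V" and p: "0 \<le> p" and x: "x \<in> A"
  shows "p * \<alpha> x \<le> \<alpha> (V \<odot> x + of_real p *s x)"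
proof -
  have VA: "V \<in> A"
    using V by (auto simp: bounded_below_shifts_def)
  let ?s = "\<alpha> V"
  have "\<alpha> (of_real (?s + p) *s x) - \<alpha> (of_real ?s *s x - V \<odot> x)
      \<le> \<alpha> (of_real (?s + p) *s x - (of_real ?s *s x - V \<odot> x))"
    using x VA by (intro reverse_triangle) auto
  moreover have "of_real (?s + p) *s x - (of_real ?s *s x - V \<odot> x) = V \<odot> x + of_real p *s x"
    by (simp add: scale_left_distrib)
  moreover have "\<alpha> (of_real (?s + p) *s x) = (?s + p) * \<alpha> x"
    using x p nonneg[OF VA] by (simp add: homogeneous del: of_real_add)
  ultimately show ?thesis
    using bounded_below_shifts_norm[OF V order_refl x] by (simp add: algebra_simps)
qed

text \<open>With P = U - V, Q = U + V and q < p for their seminorms, p + P = 2 (U + p/2) - Q and p -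
  P = 2 (V + p/2) - Q are both bounded below by p - q, hence p^2 - P^2 by (p - q)^2. Then
  \<open>strict_contraction\<close> bounds multiplication by P strictly below p, contrary to
  \<alpha>(P P) = p^2.\<close>

lemma diff_le_sum:
  assumes U: "bounded_below_shifts U" and V: "bounded_below_shifts V"
  shows "\<alpha> (U - V) \<le> \<alpha> (U + V)"
proof (rule ccontr)
  have UA: "U \<in> A" and VA: "V \<in> A" and UV_star: "star U = U" "star V = V"
    using U V by (auto simp: bounded_below_shifts_def)
  define P Q p q where "P = U - V" and "Q = U + V" and "p = \<alpha> P" and "q = \<alpha> Q"
  have PA: "P \<in> A" and QA: "Q \<in> A" and P_star: "star P = P"
    using UA VA UV_star by (auto simp: P_def Q_def star_diff)
  assume "\<not> ?thesis"
  then have pq: "q < p" by (simp add: P_def Q_def p_def q_def)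
  have q0: "0 \<le> q" using QA by (simp add: q_def)
  have lower: "(p - q) * \<alpha> x \<le> \<alpha> (of_real 2 *s (W \<odot> x + of_real (p / 2) *s x) - Q \<odot> x)"
    if W: "bounded_below_shifts W" and x: "x \<in> A" for W x
  proof -
    have WA: "W \<in> A" using W by (auto simp: bounded_below_shifts_def)
    have "\<alpha> (of_real 2 *s (W \<odot> x + of_real (p / 2) *s x)) - \<alpha> (Q \<odot> x)
        \<le> \<alpha> (of_real 2 *s (W \<odot> x + of_real (p / 2) *s x) - Q \<odot> x)"
      using WA QA x by (intro reverse_triangle) auto
    moreover have "\<alpha> (of_real 2 *s (W \<odot> x + of_real (p / 2) *s x))
        = 2 * \<alpha> (W \<odot> x + of_real (p / 2) *s x)"
      using WA x by (simp add: homogeneous)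
    moreover have "p / 2 * \<alpha> x \<le> \<alpha> (W \<odot> x + of_real (p / 2) *s x)"
      using pq q0 by (intro bounded_below_shifts_lower_bound[OF W _ x]) auto
    moreover have "\<alpha> (Q \<odot> x) \<le> q * \<alpha> x"
      using submult[OF QA x] by (simp add: q_def)
    ultimately show ?thesis by (simp add: algebra_simps)
  qed
  have two: "of_real 2 *s (y + of_real (p / 2) *s x) = y + y + of_real p *s x" for x y
    by (simp add: scale_right_distrib scale_left_distrib[of 1 1, simplified])
  have plus: "(p - q) * \<alpha> x \<le> \<alpha> (of_real p *s x + P \<odot> x)" if x: "x \<in> A" for x
  proof -
    have "of_real 2 *s (U \<odot> x + of_real (p / 2) *s x) - Q \<odot> x = of_real p *s x + P \<odot> x"
      unfolding two P_def Q_def using UA VA x by (simp add: mul_add_left mul_diff_left)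
    with lower[OF U x] show ?thesis by simp
  qed
  have minus: "(p - q) * \<alpha> x \<le> \<alpha> (of_real p *s x - P \<odot> x)" if x: "x \<in> A" for x
  proof -
    have "of_real 2 *s (V \<odot> x + of_real (p / 2) *s x) - Q \<odot> x = of_real p *s x - P \<odot> x"
      unfolding two P_def Q_def using UA VA x by (simp add: mul_add_left mul_diff_left)
    with lower[OF V x] show ?thesis by simp
  qed
  have L: "symmetric_op (\<lambda>x. P \<odot> x)"
    using symmetric_op_affine[OF PA P_star, of 0 1] by simp
  have gap: "(p - q)\<^sup>2 * \<alpha> x \<le> \<alpha> (of_real (p\<^sup>2) *s x - P \<odot> (P \<odot> x))" if x: "x \<in> A" for x
  proof -
    let ?z = "of_real p *s x - P \<odot> x"
    have "(p - q)\<^sup>2 * \<alpha> x \<le> (p - q) * \<alpha> ?z"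
      using mult_left_mono[OF minus[OF x], of "p - q"] pq by (simp add: power2_eq_square mult.assoc)
    also have "\<dots> \<le> \<alpha> (of_real p *s ?z + P \<odot> ?z)"
      using PA x by (intro plus) auto
    also have "of_real p *s ?z + P \<odot> ?z = of_real (p\<^sup>2) *s x - P \<odot> (P \<odot> x)"
      using PA x by (simp add: scale_right_diff_distrib mul_diff_right mul_scale_right power2_eq_square)
    finally show ?thesis .
  qed
  have "\<exists>\<theta><p. \<forall>x\<in>A. \<alpha> (P \<odot> x) \<le> \<theta> * \<alpha> x"
    using pq q0 PA gap
    by (intro strict_contraction[OF L, of p "(p - q)\<^sup>2"]) (auto simp: p_def submult)
  then obtain \<theta> where \<theta>: "\<theta> < p" "\<alpha> (P \<odot> P) \<le> \<theta> * p"
    using PA by (auto simp: p_def)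
  have "p * p \<le> \<theta> * p"
    using \<theta>(2) selfadjoint_power[OF PA P_star] by (simp add: p_def power2_eq_square)
  with \<theta>(1) pq q0 show False by simp
qed

text \<open>The lower bound is log-convexity along h, h^2, h^3 combined with \<alpha>(h^2) =
  \<alpha>(h)^2. It supplies the cube identity of the induced seminorm on E.\<close>

lemma selfadjoint_cube:
  assumes "h \<in> A" "star h = h"
  shows "\<alpha> (h \<odot> (h \<odot> h)) = \<alpha> h ^ 3"
proof (rule antisym)
  have L: "symmetric_op (\<lambda>x. h \<odot> x)"
    using symmetric_op_affine[OF assms, of 0 1] by simp
  show "\<alpha> (h \<odot> (h \<odot> h)) \<le> \<alpha> h ^ 3"
    using submult[of h "h \<odot> h"] assms by (simp add: selfadjoint_power power3_eq_cube power2_eq_square)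
  show "\<alpha> h ^ 3 \<le> \<alpha> (h \<odot> (h \<odot> h))"
  proof (cases "\<alpha> h = 0")
    case False
    have "\<alpha> h * \<alpha> h ^ 3 \<le> \<alpha> h * \<alpha> (h \<odot> (h \<odot> h))"
      using symmetric_op_square[OF L assms(1)] assms
      by (simp add: selfadjoint_power power3_eq_cube power2_eq_square mult_ac)
    with False nonneg[OF assms(1)] show ?thesis by simp
  qed (use assms in simp)
qed

section \<open>From spectral positivity in the completion to lower bounds in A\<close>

lemma cauchy_seqs_image:
  assumes x: "x \<in> cauchy_seqs alg \<alpha>"
    and g: "\<And>a. a \<in> A \<Longrightarrow> g a \<in> A"
    and lip: "\<And>a b. a \<in> A \<Longrightarrow> b \<in> A \<Longrightarrow> \<alpha> (g a - g b) \<le> K * \<alpha> (a - b)"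
  shows "(\<lambda>n. g (x n)) \<in> cauchy_seqs alg \<alpha>"
proof -
  have xA: "x n \<in> A" for n
    using x by (simp add: cauchy_seqs_def alg_def)
  have "\<exists>N. \<forall>m\<ge>N. \<forall>n\<ge>N. \<alpha> (g (x m) - g (x n)) < e" if e: "0 < e" for e
  proof -
    \<comment> \<open>K may be zero or negative; |K| + 1 is a positive Lipschitz constant in every
      case.\<close>
    have "0 < e / (\<bar>K\<bar> + 1)" using e by (intro divide_pos_pos) auto
    then obtain N where N: "\<And>m n. m \<ge> N \<Longrightarrow> n \<ge> N \<Longrightarrow> \<alpha> (x m - x n) < e / (\<bar>K\<bar> + 1)"
      using x unfolding cauchy_seqs_def by (fastforce simp: alg_diff_def alg_def)
    have "\<alpha> (g (x m) - g (x n)) < e" if "m \<ge> N" "n \<ge> N" for m n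
    proof -
      have "\<alpha> (g (x m) - g (x n)) \<le> (\<bar>K\<bar> + 1) * \<alpha> (x m - x n)"
        using lip[OF xA xA, of m n] mult_right_mono[of K "\<bar>K\<bar> + 1" "\<alpha> (x m - x n)"] xA by force
      also have "\<dots> < e"
        using N[OF that] by (simp add: field_simps)
      finally show ?thesis .
    qed
    then show ?thesis by blast
  qed
  then show ?thesis
    using g xA by (simp add: cauchy_seqs_def alg_diff_def alg_def)
qed

lemma completion_class_self:
  assumes "x \<in> cauchy_seqs alg \<alpha>"
  shows "x \<in> completion_class alg \<alpha> x"
  using assms by (simp add: completion_class_def null_rel_def alg_diff_def alg_def)

text \<open>The operations of the completion are unions of classes, so they contain the termwise
  results on representatives; that they are well defined is not needed.\<close>

lemma positive_approx_inverse:
  assumes V: "alg_positive alg V" and \<epsilon>: "0 < \<epsilon>"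
  shows "\<exists>b\<in>A. \<exists>t. t * of_real \<epsilon> = 1 \<and> \<alpha> (b \<odot> V + (of_real \<epsilon> *s b + t *s V)) < 1 / 2"
proof -
  let ?H = "hausdorff_completion alg \<alpha>" and ?V = "completion_map alg \<alpha> V"
  have VA: "V \<in> A" and "alg_spectrum ?H ?V \<subseteq> \<real>\<^sub>\<ge>\<^sub>0"
    using V SN by (auto simp: alg_positive_def cstar_positive_def alg_def)
  moreover have "- of_real \<epsilon> \<notin> \<real>\<^sub>\<ge>\<^sub>0"
    using \<epsilon> by (auto simp: nonneg_Reals_def complex_eq_iff)
  ultimately have "- of_real \<epsilon> \<notin> alg_spectrum ?H ?V" by blast
  \<comment> \<open>Since -\<epsilon> is outside the spectrum, V + \<epsilon> has an inverse B + t
    in the unitization of the completion.\<close>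
  then obtain B t where B: "B \<in> alg_carrier ?H"
      and inv: "unitization_mult ?H (B, t) (?V, of_real \<epsilon>) = (alg_zero ?H, 1)"
    by (auto simp: alg_spectrum_def)
  obtain x where x: "x \<in> cauchy_seqs alg \<alpha>" and Bx: "B = completion_class alg \<alpha> x"
    using B by (auto simp: hausdorff_completion_def quotient_def completion_class_def)
  have xA: "x n \<in> A" for n
    using x by (simp add: cauchy_seqs_def alg_def)
  have xB: "x \<in> B"
    unfolding Bx by (rule completion_class_self[OF x])
  have V_cauchy: "(\<lambda>n. V) \<in> cauchy_seqs alg \<alpha>"
    using VA by (simp add: cauchy_seqs_def alg_diff_def alg_def)
  then have V_mem: "(\<lambda>n. V) \<in> ?V"
    unfolding completion_map_def by (rule completion_class_self)
  have V_lip: "\<alpha> (a \<odot> V - b \<odot> V) \<le> \<alpha> V * \<alpha> (a - b)" if "a \<in> A" "b \<in> A" for a b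
    using submult[of "a - b" V] that VA by (simp add: mul_diff_left mult.commute)
  have \<epsilon>_lip: "\<alpha> (of_real \<epsilon> *s a - of_real \<epsilon> *s b) \<le> \<epsilon> * \<alpha> (a - b)" if "a \<in> A" "b \<in> A" for a b
    using that \<epsilon> by (simp add: homogeneous scale_right_diff_distrib[symmetric])
  \<comment> \<open>First coordinate of (a, t)(V, \<epsilon>) in the unitization. The second
    coordinate is 1, so this is the defect of a + t as a left inverse of V + \<epsilon>; it tends to
    0 along a representative of B.\<close>
  let ?r = "\<lambda>a. a \<odot> V + (of_real \<epsilon> *s a + t *s V)"
  have r_lip: "\<alpha> (?r a - ?r b) \<le> (\<alpha> V + \<epsilon>) * \<alpha> (a - b)" if "a \<in> A" "b \<in> A" for a b
  proof -
    have "?r a - ?r b = (a \<odot> V - b \<odot> V) + (of_real \<epsilon> *s a - of_real \<epsilon> *s b)"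
      by simp
    also have "\<alpha> \<dots> \<le> \<alpha> (a \<odot> V - b \<odot> V) + \<alpha> (of_real \<epsilon> *s a - of_real \<epsilon> *s b)"
      using that VA by (intro triangle) auto
    finally show ?thesis
      using V_lip[OF that] \<epsilon>_lip[OF that] by (simp add: distrib_right)
  qed
  have add_mem: "(\<lambda>n. f n + g n) \<in> alg_add ?H X Y"
    if "f \<in> X" "g \<in> Y" "(\<lambda>n. f n + g n) \<in> cauchy_seqs alg \<alpha>" for f g X Y
    using that(1,2) completion_class_self[OF that(3)] by (auto simp: hausdorff_completion_def alg_def)
  have mult_mem: "(\<lambda>n. x n \<odot> V) \<in> alg_mult ?H B ?V"
    using xB V_mem completion_class_self[OF cauchy_seqs_image[OF x _ V_lip]] VA
    by (auto simp: hausdorff_completion_def alg_def)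
  have scale_mem: "(\<lambda>n. of_real \<epsilon> *s x n) \<in> alg_scale ?H (of_real \<epsilon>) B"
    using xB completion_class_self[OF cauchy_seqs_image[OF x _ \<epsilon>_lip]]
    by (auto simp: hausdorff_completion_def alg_def)
  have "(\<lambda>n. t *s V) \<in> alg_scale ?H t ?V"
    using V_mem VA completion_class_self[of "\<lambda>n. t *s V"]
    by (auto simp: hausdorff_completion_def alg_def cauchy_seqs_def alg_diff_def)
  with scale_mem have "(\<lambda>n. of_real \<epsilon> *s x n + t *s V)
      \<in> alg_add ?H (alg_scale ?H (of_real \<epsilon>) B) (alg_scale ?H t ?V)"
    using cauchy_seqs_image[OF x, of "\<lambda>a. of_real \<epsilon> *s a + t *s V" \<epsilon>] \<epsilon>_lip VA
    by (intro add_mem[of "\<lambda>n. of_real \<epsilon> *s x n" _ "\<lambda>n. t *s V"]) auto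
  then have "(\<lambda>n. ?r (x n)) \<in> alg_add ?H (alg_mult ?H B ?V)
      (alg_add ?H (alg_scale ?H (of_real \<epsilon>) B) (alg_scale ?H t ?V))"
    using cauchy_seqs_image[OF x _ r_lip] VA by (intro add_mem[OF mult_mem]) auto
  then have mem: "(\<lambda>n. ?r (x n)) \<in> alg_zero ?H" and t: "t * of_real \<epsilon> = 1"
    using inv by (auto simp: unitization_mult_def)
  from mem have "(\<lambda>n. \<alpha> (0 - ?r (x n))) \<longlonglongrightarrow> 0"
    by (simp add: hausdorff_completion_def completion_class_def null_rel_def alg_diff_def alg_def)
  then have "(\<lambda>n. \<alpha> (?r (x n))) \<longlonglongrightarrow> 0"
    using xA VA by (simp only: diff_0 minus closed mul_closed)
  then have "\<forall>\<^sub>F n in sequentially. \<alpha> (?r (x n)) < 1 / 2"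
    by (rule order_tendstoD) simp
  then obtain n where "\<alpha> (?r (x n)) < 1 / 2"
    by (auto simp: eventually_sequentially)
  with t xA show ?thesis by blast
qed

text \<open>In the unitization (b + t)(V + \<epsilon>) = 1 + r with \<alpha> r < 1/2. Applied to x,
  this gives \<alpha>(x)/2 \<le> (\<alpha> b + |t|) \<alpha>(V x + \<epsilon> x), so an approximate
  inverse in A suffices.\<close>

lemma bounded_below_shifts_if_positive:
  assumes V: "alg_positive alg V" and V_star: "star V = V"
  shows "bounded_below_shifts V"
  unfolding bounded_below_shifts_def
proof (intro conjI allI impI)
  show VA: "V \<in> A" using V by (simp add: alg_positive_def alg_def)
  fix \<epsilon> :: real assume "0 < \<epsilon>"
  then obtain b t where b: "b \<in> A" and t: "t * of_real \<epsilon> = 1"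
      and r: "\<alpha> (b \<odot> V + (of_real \<epsilon> *s b + t *s V)) < 1 / 2"
    using positive_approx_inverse[OF V] by blast
  define K where "K = 2 * (\<alpha> b + cmod t) + 1"
  have K: "0 < K" using nonneg[OF b] by (simp add: K_def add_nonneg_pos)
  have "1 / K * \<alpha> x \<le> \<alpha> (V \<odot> x + of_real \<epsilon> *s x)" if x: "x \<in> A" for x
  proof -
    let ?r = "b \<odot> V + (of_real \<epsilon> *s b + t *s V)" and ?y = "V \<odot> x + of_real \<epsilon> *s x"
    have "x = (b \<odot> ?y + t *s ?y) - ?r \<odot> x"
      using b VA x t
      by (simp add: mul_add_left mul_add_right mul_scale_left mul_scale_right mul_assoc
          scale_right_distrib algebra_simps)
    then have "\<alpha> x \<le> \<alpha> (b \<odot> ?y + t *s ?y) + \<alpha> (?r \<odot> x)"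
      using triangle_diff[of "b \<odot> ?y + t *s ?y" "?r \<odot> x"] b VA x by simp
    also have "\<alpha> (b \<odot> ?y + t *s ?y) \<le> \<alpha> (b \<odot> ?y) + \<alpha> (t *s ?y)"
      using b VA x by (intro triangle) auto
    also have "\<alpha> (b \<odot> ?y) \<le> \<alpha> b * \<alpha> ?y"
      using b VA x by (intro submult) auto
    also have "\<alpha> (t *s ?y) = cmod t * \<alpha> ?y"
      using VA x by (intro homogeneous) auto
    also have "\<alpha> (?r \<odot> x) \<le> 1 / 2 * \<alpha> x"
      using submult[of ?r x] mult_right_mono[OF less_imp_le[OF r] nonneg[OF x]] b VA x by force
    finally have "\<alpha> x \<le> 2 * (\<alpha> b + cmod t) * \<alpha> ?y"
      by (simp add: algebra_simps)
    also have "\<dots> \<le> K * \<alpha> ?y"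
      using VA x by (intro mult_right_mono) (auto simp: K_def)
    finally show ?thesis using K by (simp add: field_simps)
  qed
  with K show "\<exists>\<kappa>>0. \<forall>x\<in>A. \<kappa> * \<alpha> x \<le> \<alpha> (V \<odot> x + of_real \<epsilon> *s x)"
    by (intro exI[of _ "1 / K"]) auto
qed (rule V_star)

end

section \<open>The algebra of right operators\<close>

context admissible_star_tring
begin

abbreviation "E0 \<equiv> alg_carrier (E0r scale tp)"
abbreviation "inner \<equiv> r_inner tp"
abbreviation "adj \<equiv> r_star scale tp"

lemma tp_add_fst: "tp (a + b) u v = tp a u v + tp b u v"
  and tp_scale_fst: "tp (scale k a) u v = scale k (tp a u v)"
  and tp_add_trd: "tp u v (a + b) = tp u v a + tp u v b"
  and tp_scale_trd: "tp u v (scale k a) = scale k (tp u v a)"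
  using linear_fst[of u v] linear_trd[of u v]
  by (auto simp: module_hom_iff_linear[symmetric] module_hom_def module_hom_axioms_def)

lemma tp_diff_snd: "tp a (u - v) b = tp a u b - tp a v b"
  using add_snd[of a "u - v" v b] by (simp add: algebra_simps)

lemma tp_diff_trd: "tp a b (u - v) = tp a b u - tp a b v"
  using tp_add_trd[of a b "u - v" v] by (simp add: algebra_simps)

lemma tp_zero [simp]: "tp 0 u v = 0" "tp u 0 v = 0" "tp u v 0 = 0"
  using tp_add_fst[of 0 0 u v] add_snd[of u 0 0 v] tp_add_trd[of u v 0 0] by auto

lemma tp_sum_fst: "tp (\<Sum>i\<in>I. g i) u v = (\<Sum>i\<in>I. tp (g i) u v)"
  by (induction I rule: infinite_finite_induct) (auto simp: tp_add_fst)

lemma tp_sum_snd: "tp u (\<Sum>i\<in>I. g i) v = (\<Sum>i\<in>I. tp u (g i) v)"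
  by (induction I rule: infinite_finite_induct) (auto simp: add_snd)

text \<open>Admissibility, with u = v = p - q, makes the triple product nondegenerate in its middle
  argument.\<close>

lemma tp_snd_cancel:
  assumes "\<And>u v. tp u p v = tp u q v"
  shows "p = q"
  using admissible[of "p - q"] assms by (simp add: tp_diff_snd)

lemma vector_space_op_scale: "vector_space (op_scale scale)"
  by unfold_locales
    (auto simp: op_scale_def fun_eq_iff scale_right_distrib scale_left_distrib)

lemma E0_eq: "E0 = module.span (op_scale scale) {inner y z | y z. True}"
  by (simp add: E0r_def)

lemma E0_inner [simp]: "inner y z \<in> E0"
proof -
  interpret op: vector_space "op_scale scale" by (rule vector_space_op_scale)
  show ?thesis unfolding E0_eq by (rule op.span_base) blast
qed

lemma E0_closed:
  shows E0_zero: "0 \<in> E0"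
    and E0_add: "S \<in> E0 \<Longrightarrow> T \<in> E0 \<Longrightarrow> S + T \<in> E0"
    and E0_scale: "T \<in> E0 \<Longrightarrow> op_scale scale c T \<in> E0"
proof -
  interpret op: vector_space "op_scale scale" by (rule vector_space_op_scale)
  show "0 \<in> E0" "S \<in> E0 \<Longrightarrow> T \<in> E0 \<Longrightarrow> S + T \<in> E0" "T \<in> E0 \<Longrightarrow> op_scale scale c T \<in> E0"
    unfolding E0_eq by (auto intro: op.span_zero op.span_add op.span_scale)
qed

lemma E0_induct [consumes 1, case_names zero step]:
  assumes "T \<in> E0"
    and "P 0"
    and "\<And>c y z S. S \<in> E0 \<Longrightarrow> P S \<Longrightarrow> P (op_scale scale c (inner y z) + S)"
  shows "P T"
proof -
  interpret op: vector_space "op_scale scale" by (rule vector_space_op_scale)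
  have "T \<in> E0 \<and> P T"
    using assms(1) unfolding E0_eq
  proof (induction rule: op.span_induct_alt)
    case (step c x S)
    then obtain y z where "x = inner y z" by blast
    with step.IH assms(3)[of S c y z] E0_add[OF E0_scale[OF E0_inner], of S c y z]
    show "op_scale scale c x + S \<in> op.span {inner y z |y z. True} \<and> P (op_scale scale c x + S)"
      by (simp add: E0_eq)
  next
    case base
    from assms(2) E0_zero show "0 \<in> op.span {inner y z |y z. True} \<and> P 0"
      by (simp add: E0_eq)
  qed
  then show ?thesis ..
qed

lemma E0_representation:
  assumes "T \<in> E0"
  obtains n :: nat and c y z where "T = (\<Sum>i<n. op_scale scale (c i) (inner (y i) (z i)))"
proof -
  from assms have "\<exists>(n::nat) c y z. T = (\<Sum>i<n. op_scale scale (c i) (inner (y i) (z i)))"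
  proof (induction rule: E0_induct)
    case zero
    show ?case by (rule exI[of _ 0]) simp
  next
    case (step c y z S)
    then obtain n :: nat and c' y' z' where
      S: "S = (\<Sum>i<n. op_scale scale (c' i) (inner (y' i) (z' i)))" by blast
    have "op_scale scale c (inner y z) + S = (\<Sum>i<Suc n.
        op_scale scale ((c'(n := c)) i) (inner ((y'(n := y)) i) ((z'(n := z)) i)))"
      by (simp add: S add.commute)
    then show ?case by blast
  qed
  with that show ?thesis by blast
qed

lemma E0_linear:
  assumes "T \<in> E0"
  shows E0_apply_add: "T (a + b) = T a + T b"
    and E0_apply_scale: "T (scale k a) = scale k (T a)"
  using assms
proof (induction rule: E0_induct)
  case (step c y z S)
  { case 1 then show ?case
      using step by (simp add: op_scale_def r_inner_def tp_add_fst scale_right_distrib) }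
  { case 2 then show ?case
      using step by (simp add: op_scale_def r_inner_def tp_scale_fst scale_right_distrib mult.commute) }
qed auto

lemma E0_apply_zero: "T \<in> E0 \<Longrightarrow> T 0 = 0"
  using E0_apply_add[of T 0 0] by simp

lemma adj_closed: "T \<in> E0 \<Longrightarrow> adj T \<in> E0"
proof (elim E0_representation)
  fix n :: nat and c y z
  assume T: "T = (\<Sum>i<n. op_scale scale (c i) (inner (y i) (z i)))"
  interpret op: vector_space "op_scale scale" by (rule vector_space_op_scale)
  show "adj T \<in> E0"
    unfolding T r_star_sum E0_eq
    by (intro op.span_sum op.span_scale op.span_base) blast
qed

lemma adj_adj: "T \<in> E0 \<Longrightarrow> adj (adj T) = T"
  by (elim E0_representation) (simp add: r_star_sum)

lemma tp_adj: "T \<in> E0 \<Longrightarrow> tp u (adj T x) v = tp (T u) x v"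
proof (elim E0_representation)
  fix n :: nat and c y z
  assume T: "T = (\<Sum>i<n. op_scale scale (c i) (inner (y i) (z i)))"
  show ?thesis
    unfolding T r_star_sum
    by (simp add: sum_fun_apply op_scale_def r_inner_def tp_sum_fst tp_sum_snd scale_snd
        tp_scale_fst assoc_mid)
qed

text \<open>Nondegeneracy and \<open>tp_adj\<close> determine the adjoint, so the laws of the
  involution can be checked without writing operators as sums.\<close>

lemma adj_eqI:
  assumes "T \<in> E0" "\<And>u x v. tp u (S x) v = tp (T u) x v"
  shows "adj T = S"
  by (rule ext, rule tp_snd_cancel) (simp add: tp_adj assms)

lemma adj_inner: "adj (inner y z) = inner z y"
  by (rule adj_eqI[OF E0_inner]) (simp add: r_inner_def assoc_mid)

lemma inner_apply_right: "T \<in> E0 \<Longrightarrow> inner y (T z) = T \<circ> inner y z"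
proof (induction rule: E0_induct)
  case (step c u v S)
  then show ?case
    by (auto simp: fun_eq_iff r_inner_def op_scale_def tp_add_trd tp_scale_trd assoc_right)
qed (simp add: fun_eq_iff r_inner_def)

lemma inner_apply_left: "T \<in> E0 \<Longrightarrow> inner (T y) z = inner y z \<circ> adj T"
  using tp_adj[of "adj T"] by (auto simp: fun_eq_iff r_inner_def adj_closed adj_adj)

text \<open>A generator absorbs T: T \<circ> <y, z> = <y, T z>.\<close>

lemma E0_comp: "S \<in> E0 \<Longrightarrow> T \<in> E0 \<Longrightarrow> T \<circ> S \<in> E0"
proof (induction rule: E0_induct)
  case zero
  then have "T \<circ> 0 = 0" by (simp add: fun_eq_iff E0_apply_zero)
  with E0_zero show "T \<circ> 0 \<in> E0" by metis
next
  case (step c y z S)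
  then have "T \<circ> (op_scale scale c (inner y z) + S) = op_scale scale c (inner y (T z)) + (T \<circ> S)"
    by (simp add: inner_apply_right) (simp add: fun_eq_iff op_scale_def E0_apply_add E0_apply_scale)
  moreover have "T \<circ> S \<in> E0"
    using step.prems by (rule step.IH)
  then have "op_scale scale c (inner y (T z)) + (T \<circ> S) \<in> E0"
    by (intro E0_add E0_scale E0_inner)
  ultimately show "T \<circ> (op_scale scale c (inner y z) + S) \<in> E0" by metis
qed

text \<open>Since the product is reversed composition, the element a* a of the algebra reads
  \<open>a \<circ> adj a\<close>.\<close>

sublocale E0: star_algebra_on "op_scale scale" E0 "\<lambda>S T. T \<circ> S" adj
proof -
  interpret op: vector_space "op_scale scale" by (rule vector_space_op_scale)
  show "star_algebra_on (op_scale scale) E0 (\<lambda>S T. T \<circ> S) adj"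
  proof unfold_locales
    show "op.subspace E0" unfolding E0_eq by (rule op.subspace_span)
    fix S T U c
    assume S: "S \<in> E0" and T: "T \<in> E0"
    show "T \<circ> S \<in> E0" using S T by (rule E0_comp)
    show "adj S \<in> E0" "adj (adj S) = S" using S by (rule adj_closed adj_adj)+
    show "T \<circ> op_scale scale c S = op_scale scale c (T \<circ> S)"
      using T by (simp add: fun_eq_iff op_scale_def E0_apply_scale)
    show "op_scale scale c T \<circ> S = op_scale scale c (T \<circ> S)"
      by (simp add: fun_eq_iff op_scale_def)
    show "adj (S + T) = adj S + adj T"
      using S T by (intro adj_eqI E0_add) (simp_all add: add_snd tp_add_fst tp_adj)
    show "adj (op_scale scale c S) = op_scale scale (cnj c) (adj S)"
      using E0_scale[OF S] S
      by (intro adj_eqI) (simp_all add: op_scale_def scale_snd tp_scale_fst tp_adj)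
    show "adj (T \<circ> S) = adj S \<circ> adj T"
      using S T by (intro adj_eqI E0_comp) (simp_all add: tp_adj)
    assume U: "U \<in> E0"
    show "U \<circ> (S + T) = (U \<circ> S) + (U \<circ> T)"
      using U by (simp add: fun_eq_iff E0_apply_add)
    show "(T + U) \<circ> S = (T \<circ> S) + (U \<circ> S)" "U \<circ> (T \<circ> S) = U \<circ> T \<circ> S"
      by (simp_all add: fun_eq_iff)
  qed
qed

lemma E0_alg: "E0.alg = E0r scale tp"
  by (simp add: E0.alg_def) (simp add: E0r_def)

lemma cstar_seminormed_E0:
  "\<alpha> \<in> alg_SN (E0r scale tp) \<Longrightarrow> cstar_seminormed (op_scale scale) E0 (\<lambda>S T. T \<circ> S) adj \<alpha>"
  by unfold_locales (simp add: E0_alg)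

lemma inner_add_left: "inner (y + y') z = inner y z + inner y' z"
  and inner_add_right: "inner y (z + z') = inner y z + inner y z'"
  and inner_diff_left: "inner (y - y') z = inner y z - inner y' z"
  and inner_diff_right: "inner y (z - z') = inner y z - inner y z'"
  and inner_scale_left: "inner (scale c y) z = op_scale scale (cnj c) (inner y z)"
  and inner_scale_right: "inner y (scale c z) = op_scale scale c (inner y z)"
  by (auto simp: fun_eq_iff r_inner_def op_scale_def add_snd tp_add_trd tp_diff_snd tp_diff_trd
      scale_snd tp_scale_trd)

section \<open>Seminorms on the ring induced by seminorms on the algebra\<close>

definition tring_seminorm :: "(('e \<Rightarrow> 'e) \<Rightarrow> real) \<Rightarrow> 'e \<Rightarrow> real" where
  "tring_seminorm \<alpha> x = sqrt (\<alpha> (inner x x))"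

lemma tring_seminorm_sq:
  assumes "\<alpha> \<in> alg_SN (E0r scale tp)"
  shows "(tring_seminorm \<alpha> x)\<^sup>2 = \<alpha> (inner x x)"
proof -
  interpret cstar_seminormed "op_scale scale" E0 "\<lambda>S T. T \<circ> S" adj \<alpha>
    by (rule cstar_seminormed_E0[OF assms])
  show ?thesis by (simp add: tring_seminorm_def)
qed

lemma tring_seminorm_nonneg:
  assumes "\<alpha> \<in> alg_SN (E0r scale tp)"
  shows "0 \<le> tring_seminorm \<alpha> x"
proof -
  interpret cstar_seminormed "op_scale scale" E0 "\<lambda>S T. T \<circ> S" adj \<alpha>
    by (rule cstar_seminormed_E0[OF assms])
  show ?thesis by (simp add: tring_seminorm_def)
qed

text \<open>In the reversed product, <T x, T x> is T* <x, x> T.\<close>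

lemma inner_apply_le:
  assumes "\<alpha> \<in> alg_SN (E0r scale tp)" "T \<in> E0"
  shows "\<alpha> (inner (T x) (T x)) \<le> (\<alpha> T)\<^sup>2 * \<alpha> (inner x x)"
proof -
  interpret cstar_seminormed "op_scale scale" E0 "\<lambda>S T. T \<circ> S" adj \<alpha>
    by (rule cstar_seminormed_E0[OF assms(1)])
  have "inner (T x) (T x) = T \<circ> (inner x x \<circ> adj T)"
    by (simp add: inner_apply_right inner_apply_left assms(2))
  then have "\<alpha> (inner (T x) (T x)) \<le> \<alpha> (inner x x \<circ> adj T) * \<alpha> T"
    using submult[of "inner x x \<circ> adj T" T] assms(2) by (simp add: E0_comp adj_closed)
  also have "\<dots> \<le> (\<alpha> (adj T) * \<alpha> (inner x x)) * \<alpha> T"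
    using submult[of "adj T" "inner x x"] assms(2) by (intro mult_right_mono) (auto simp: adj_closed)
  finally show ?thesis
    using assms(2) by (simp add: star_isometric power2_eq_square mult_ac)
qed

lemma tring_seminorm_apply_le:
  assumes "\<alpha> \<in> alg_SN (E0r scale tp)" "T \<in> E0"
  shows "tring_seminorm \<alpha> (T x) \<le> \<alpha> T * tring_seminorm \<alpha> x"
proof -
  interpret cstar_seminormed "op_scale scale" E0 "\<lambda>S T. T \<circ> S" adj \<alpha>
    by (rule cstar_seminormed_E0[OF assms(1)])
  show ?thesis
    using real_sqrt_le_mono[OF inner_apply_le[OF assms]] assms(2)
    by (simp add: tring_seminorm_def real_sqrt_mult)
qed

lemma inner_cauchy_schwarz:
  assumes \<alpha>_SN: "\<alpha> \<in> alg_SN (E0r scale tp)" and pos: "right_positive scale tp"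
  shows "(\<alpha> (inner x y))\<^sup>2 \<le> \<alpha> (inner x x) * \<alpha> (inner y y)"
proof -
  interpret cstar_seminormed "op_scale scale" E0 "\<lambda>S T. T \<circ> S" adj \<alpha>
    by (rule cstar_seminormed_E0[OF \<alpha>_SN])
  have bb: "bounded_below_shifts (inner u u)" for u
    using pos by (intro bounded_below_shifts_if_positive) (auto simp: right_positive_def E0_alg adj_inner)
  have weak: "2 * (\<alpha> (inner x y))\<^sup>2 \<le> \<alpha> (inner x x) * (\<alpha> (inner x y))\<^sup>2 + \<alpha> (inner y y)" for x
  proof -
    define a where "a = inner x y"
    let ?w = "a x"
    let ?U = "inner (?w + y) (?w + y)" and ?V = "inner (?w - y) (?w - y)"
    have aA: "a \<in> E0" by (simp add: a_def)
    \<comment> \<open>Both cross terms become a* a, because <x a, y> = a* <x, y>; this dictates the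
      factor a = <x, y>.\<close>
    have wy: "inner ?w y = a \<circ> adj a" "inner y ?w = a \<circ> adj a"
      using inner_apply_left[OF aA, of x y] inner_apply_right[OF aA, of y x]
      by (auto simp: a_def adj_inner)
    have aaA: "a \<circ> adj a \<in> E0" using aA by (simp add: E0_comp adj_closed)
    have four: "op_scale scale 4 S = S + S + S + S" for S
      using E0.scale_left_distrib[of 2 2 S] E0.scale_left_distrib[of 1 1 S] by (simp add: add.assoc)
    have two: "op_scale scale 2 S = S + S" for S
      using E0.scale_left_distrib[of 1 1 S] by simp
    have "?U - ?V = op_scale scale 4 (a \<circ> adj a)"
      by (simp add: inner_add_left inner_add_right inner_diff_left inner_diff_right wy four)
    moreover have "\<alpha> (op_scale scale 4 (a \<circ> adj a)) = 4 * (\<alpha> a)\<^sup>2"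
      using homogeneous[OF aaA, of 4] cstar[OF aA] by simp
    ultimately have "4 * (\<alpha> a)\<^sup>2 = \<alpha> (?U - ?V)" by simp
    also have "\<dots> \<le> \<alpha> (?U + ?V)" by (intro diff_le_sum bb)
    also have "?U + ?V = op_scale scale 2 (inner ?w ?w + inner y y)"
      by (simp add: inner_add_left inner_add_right inner_diff_left inner_diff_right two)
    also have "\<alpha> \<dots> = 2 * \<alpha> (inner ?w ?w + inner y y)"
      by (simp add: homogeneous)
    also have "\<alpha> (inner ?w ?w + inner y y) \<le> (\<alpha> a)\<^sup>2 * \<alpha> (inner x x) + \<alpha> (inner y y)"
      using triangle[of "inner ?w ?w" "inner y y"] inner_apply_le[OF \<alpha>_SN aA, of x] by simp
    finally show ?thesis by (simp add: a_def mult.commute)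
  qed
  define s h k where "s = (\<alpha> (inner x y))\<^sup>2" and "h = \<alpha> (inner x x)" and "k = \<alpha> (inner y y)"
  have nn: "0 \<le> s" "0 \<le> h" "0 \<le> k" by (auto simp: s_def h_def k_def)
  \<comment> \<open>Replacing x by sqrt(t) x multiplies both s and h by t. The resulting left part 2
    t s - t^2 h s is largest at t = 1/h.\<close>
  have scaled: "2 * t * s \<le> t\<^sup>2 * h * s + k" if t: "0 < t" for t
  proof -
    let ?c = "of_real (sqrt t) :: complex"
    have "\<alpha> (inner (scale ?c x) y) = sqrt t * \<alpha> (inner x y)"
      using t by (simp add: inner_scale_left homogeneous)
    moreover have "\<alpha> (inner (scale ?c x) (scale ?c x)) = t * h"
      using t by (simp add: inner_scale_left inner_scale_right homogeneous h_def norm_mult mult.assoc[symmetric])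
    moreover have "(sqrt t * \<alpha> (inner x y))\<^sup>2 = t * s"
      using t by (simp add: s_def power_mult_distrib)
    ultimately show ?thesis
      using weak[of "scale ?c x"] by (simp add: k_def power2_eq_square mult_ac)
  qed
  have "s \<le> h * k"
  proof (cases "h = 0")
    case False
    with nn scaled[of "1 / h"] show ?thesis by (simp add: field_simps power2_eq_square)
  next
    case True
    have "s = 0"
    proof (rule ccontr)
      assume "s \<noteq> 0"
      \<comment> \<open>For h = 0 the inequality reads 2 t s \<le> k for all t > 0, which this t
        violates.\<close>
      with nn scaled[of "(k + 1) / s"] True show False by simp
    qed
    with True show ?thesis by simp
  qed
  then show ?thesis by (simp add: s_def h_def k_def)
qed

lemma inner_le_tring_seminorm:
  assumes \<alpha>_SN: "\<alpha> \<in> alg_SN (E0r scale tp)" and pos: "right_positive scale tp"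
  shows "\<alpha> (inner x y) \<le> tring_seminorm \<alpha> x * tring_seminorm \<alpha> y"
  using real_le_rsqrt[OF inner_cauchy_schwarz[OF assms, of x y]]
  by (simp add: tring_seminorm_def real_sqrt_mult)

text \<open>Cauchy-Schwarz gives the triangle inequality as in a Hilbert space, and together with
  the module estimate it bounds the triple product. For h = <x, x> one has (x, x, x) = h x and <h x,
  h x> = h^3, which leads to \<open>selfadjoint_cube\<close>.\<close>

lemma tring_seminorm_in_SN:
  assumes \<alpha>_SN: "\<alpha> \<in> alg_SN (E0r scale tp)" and pos: "right_positive scale tp"
  shows "tring_seminorm \<alpha> \<in> tring_SN scale tp"
proof -
  interpret cstar_seminormed "op_scale scale" E0 "\<lambda>S T. T \<circ> S" adj \<alpha>
    by (rule cstar_seminormed_E0[OF \<alpha>_SN])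
  let ?\<gamma> = "tring_seminorm \<alpha>"
  note nn = tring_seminorm_nonneg[OF \<alpha>_SN] and sq = tring_seminorm_sq[OF \<alpha>_SN]
    and CS = inner_le_tring_seminorm[OF assms]
  have "?\<gamma> (x + y) \<le> ?\<gamma> x + ?\<gamma> y" for x y
  proof (rule power2_le_imp_le)
    have "(?\<gamma> (x + y))\<^sup>2 = \<alpha> ((inner x x + inner x y) + (inner y x + inner y y))"
      by (simp add: sq inner_add_left inner_add_right add_ac)
    also have "\<dots> \<le> \<alpha> (inner x x) + \<alpha> (inner x y) + (\<alpha> (inner y x) + \<alpha> (inner y y))"
      using triangle[of "inner x x + inner x y" "inner y x + inner y y"]
        triangle[of "inner x x" "inner x y"] triangle[of "inner y x" "inner y y"] by simp
    also have "\<dots> \<le> (?\<gamma> x + ?\<gamma> y)\<^sup>2"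
      unfolding sq[symmetric] power2_sum using CS[of x y] CS[of y x] mult.commute[of "?\<gamma> x" "?\<gamma> y"]
      by linarith
    finally show "(?\<gamma> (x + y))\<^sup>2 \<le> (?\<gamma> x + ?\<gamma> y)\<^sup>2" .
  qed (simp add: nn)
  moreover have "?\<gamma> (scale c x) = cmod c * ?\<gamma> x" for c x
    by (simp add: tring_seminorm_def inner_scale_left inner_scale_right homogeneous real_sqrt_mult
        norm_mult mult.assoc[symmetric])
  moreover have "?\<gamma> (tp x y z) \<le> ?\<gamma> x * ?\<gamma> y * ?\<gamma> z" for x y z
  proof -
    have "?\<gamma> (tp x y z) \<le> \<alpha> (inner y z) * ?\<gamma> x"
      using tring_seminorm_apply_le[OF \<alpha>_SN E0_inner[of y z], of x] by (simp add: r_inner_def)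
    also have "\<dots> \<le> ?\<gamma> y * ?\<gamma> z * ?\<gamma> x"
      using CS nn by (intro mult_right_mono) auto
    finally show ?thesis by (simp add: mult_ac)
  qed
  moreover have "?\<gamma> (tp x x x) = ?\<gamma> x ^ 3" for x
  proof -
    let ?h = "inner x x"
    have "inner (?h x) (?h x) = ?h \<circ> (?h \<circ> ?h)"
      by (subst inner_apply_right, simp, subst inner_apply_left) (auto simp: adj_inner)
    then have "(?\<gamma> (?h x))\<^sup>2 = \<alpha> ?h ^ 3"
      using selfadjoint_cube[of ?h] by (simp add: sq adj_inner comp_assoc)
    also have "\<dots> = (?\<gamma> x ^ 3)\<^sup>2"
      by (simp add: sq[symmetric] power_mult[symmetric] mult.commute)
    finally have "?\<gamma> (?h x) = ?\<gamma> x ^ 3"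
      by (rule power2_eq_imp_eq) (simp_all add: nn)
    then show ?thesis by (simp add: r_inner_def)
  qed
  ultimately show ?thesis
    using nn by (simp add: tring_SN_def)
qed

section \<open>Recovering the order on the algebra from the ring\<close>

text \<open>If b < a, division by a^(2^j) leaves a on the left, while the right-hand side tends to
  0.\<close>

lemma le_if_power_le:
  fixes a b C :: real
  assumes "0 \<le> a" "0 \<le> b" and le: "\<And>j::nat. a ^ Suc (2 ^ j) \<le> C * b ^ 2 ^ j"
  shows "a \<le> b"
proof (rule ccontr)
  assume "\<not> a \<le> b"
  then have a: "0 < a" and ba: "b / a < 1" using assms(2) by auto
  obtain j where j: "(b / a) ^ j < a / (\<bar>C\<bar> + 1)"
    using real_arch_pow_inv[of "a / (\<bar>C\<bar> + 1)" "b / a"] a ba by (auto simp: add_nonneg_pos)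
  have "(b / a) ^ 2 ^ j \<le> (b / a) ^ j"
    using assms(2) a ba less_exp[of j] by (intro power_decreasing) (auto intro: less_imp_le)
  then have "(\<bar>C\<bar> + 1) * (b / a) ^ 2 ^ j \<le> (\<bar>C\<bar> + 1) * (b / a) ^ j"
    by (intro mult_left_mono) auto
  moreover have "(\<bar>C\<bar> + 1) * (b / a) ^ j < a"
    using j by (subst (asm) pos_less_divide_eq) (auto simp: mult.commute)
  moreover have "a \<le> C * (b / a) ^ 2 ^ j"
    using le[of j] a by (simp add: power_divide field_simps)
  moreover have "C * (b / a) ^ 2 ^ j \<le> (\<bar>C\<bar> + 1) * (b / a) ^ 2 ^ j"
    using assms(2) a by (intro mult_right_mono) auto
  ultimately show False by linarith
qed

text \<open>For fixed $b$ one has $\alpha(b c) \le C_b \beta(c)$; with $b = h = h^*$ and $c = h^n$ the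
  constant disappears as $n \to \infty$.\<close>

lemma tring_seminorm_reflects_le:
  assumes \<alpha>: "\<alpha> \<in> alg_SN (E0r scale tp)" and \<beta>: "\<beta> \<in> alg_SN (E0r scale tp)"
    and pos: "right_positive scale tp"
    and le: "\<And>x. tring_seminorm \<alpha> x \<le> tring_seminorm \<beta> x" and T: "T \<in> E0"
  shows "\<alpha> T \<le> \<beta> T"
proof -
  interpret \<alpha>: cstar_seminormed "op_scale scale" E0 "\<lambda>S T. T \<circ> S" adj \<alpha>
    by (rule cstar_seminormed_E0[OF \<alpha>])
  interpret \<beta>: cstar_seminormed "op_scale scale" E0 "\<lambda>S T. T \<circ> S" adj \<beta>
    by (rule cstar_seminormed_E0[OF \<beta>])
  \<comment> \<open>For b = <y, z> one has c \<circ> b = <y, c z>. Cauchy-Schwarz for \<alpha> and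
    the hypothesis leave the factor \<gamma>_\<beta>(c z) \<le> \<beta>(c) \<gamma>_\<beta>(z), so c
    is measured by \<beta> alone; the constants add up over the span.\<close>
  have bound: "\<exists>C. \<forall>c\<in>E0. \<alpha> (c \<circ> b) \<le> C * \<beta> c" if "b \<in> E0" for b
    using that
  proof (induction rule: E0_induct)
    case zero
    have "c \<circ> 0 = 0" if "c \<in> E0" for c
      using that by (simp add: fun_eq_iff E0_apply_zero)
    then have "\<forall>c\<in>E0. \<alpha> (c \<circ> 0) \<le> 0 * \<beta> c" by (metis \<alpha>.zero mult_zero_left order_refl)
    then show "\<exists>C. \<forall>c\<in>E0. \<alpha> (c \<circ> 0) \<le> C * \<beta> c" by blast
  next
    case (step k y z S)
    then obtain C where C: "\<And>c. c \<in> E0 \<Longrightarrow> \<alpha> (c \<circ> S) \<le> C * \<beta> c" by blast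
    let ?K = "cmod k * (tring_seminorm \<alpha> y * tring_seminorm \<beta> z)"
    have "\<alpha> (c \<circ> (op_scale scale k (inner y z) + S)) \<le> (?K + C) * \<beta> c" if c: "c \<in> E0" for c
    proof -
      have "c \<circ> (op_scale scale k (inner y z) + S) = op_scale scale k (inner y (c z)) + (c \<circ> S)"
        using c by (simp add: inner_apply_right)
          (simp add: fun_eq_iff op_scale_def E0_apply_add E0_apply_scale)
      then have "\<alpha> (c \<circ> (op_scale scale k (inner y z) + S))
          \<le> cmod k * \<alpha> (inner y (c z)) + \<alpha> (c \<circ> S)"
        using \<alpha>.triangle[of "op_scale scale k (inner y (c z))" "c \<circ> S"] c step.hyps
        by (simp add: E0_comp E0_scale \<alpha>.homogeneous)
      also have "\<alpha> (c \<circ> S) \<le> C * \<beta> c" using C[OF c] .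
      finally have "\<alpha> (c \<circ> (op_scale scale k (inner y z) + S))
          \<le> cmod k * \<alpha> (inner y (c z)) + C * \<beta> c" by simp
      moreover have "cmod k * \<alpha> (inner y (c z))
          \<le> cmod k * (tring_seminorm \<alpha> y * (\<beta> c * tring_seminorm \<beta> z))"
      proof (rule mult_left_mono)
        have "tring_seminorm \<alpha> (c z) \<le> \<beta> c * tring_seminorm \<beta> z"
          using le[of "c z"] tring_seminorm_apply_le[OF \<beta> c, of z] by linarith
        then have "tring_seminorm \<alpha> y * tring_seminorm \<alpha> (c z)
            \<le> tring_seminorm \<alpha> y * (\<beta> c * tring_seminorm \<beta> z)"
          using tring_seminorm_nonneg[OF \<alpha>] by (intro mult_left_mono)
        with inner_le_tring_seminorm[OF \<alpha> pos, of y "c z"]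
        show "\<alpha> (inner y (c z)) \<le> tring_seminorm \<alpha> y * (\<beta> c * tring_seminorm \<beta> z)"
          by linarith
      qed simp
      ultimately show ?thesis by (simp add: algebra_simps)
    qed
    then show "\<exists>C. \<forall>c\<in>E0. \<alpha> (c \<circ> (op_scale scale k (inner y z) + S)) \<le> C * \<beta> c" by blast
  qed
  have selfadjoint: "\<alpha> h \<le> \<beta> h" if h: "h \<in> E0" "adj h = h" for h
  proof -
    obtain C where C: "\<And>c. c \<in> E0 \<Longrightarrow> \<alpha> (c \<circ> h) \<le> C * \<beta> c"
      using bound[OF h(1)] by blast
    \<comment> \<open>L multiplies by h, so \<open>(L ^^ n) h\<close> is h^(n + 1); hence the
      shifted exponents below.\<close>
    define L where "L = (\<lambda>S :: 'e \<Rightarrow> 'e. S \<circ> h)"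
    have L_Suc: "(L ^^ Suc n) h = (L ^^ n) h \<circ> h" for n
      using fun_cong[OF funpow.simps(2)[of n L], of h] by (simp only: comp_apply[of L]) (simp only: L_def)
    have L: "E0.symmetric_op L"
      using E0.symmetric_op_affine[OF h, of 0 1] by (simp add: L_def)
    have powA: "(L ^^ n) h \<in> E0" for n
      using E0.symmetric_op_closed[OF E0.symmetric_op_funpow[OF L] h(1)] .
    have pow_le: "\<beta> ((L ^^ n) h) \<le> \<beta> h ^ Suc n" for n
    proof (induction n)
      case (Suc n)
      have "\<beta> ((L ^^ Suc n) h) \<le> \<beta> h * \<beta> ((L ^^ n) h)"
        unfolding L_Suc by (rule \<beta>.submult[OF h(1) powA])
      also have "\<dots> \<le> \<beta> h * \<beta> h ^ Suc n"
        by (intro mult_left_mono Suc \<beta>.nonneg h(1))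
      finally show ?case by simp
    qed simp
    show ?thesis
    proof (cases "\<alpha> h = 0")
      case False
      then have a: "0 < \<alpha> h" using \<alpha>.nonneg[OF h(1)] by linarith
      show ?thesis
      proof (rule le_if_power_le)
        fix j :: nat
        \<comment> \<open>\<open>symmetric_op_power\<close> bounds \<alpha>(h^2)^(2^j) =
          \<alpha>(h)^(2^(j+1)). Cancelling \<alpha>(h)^(2^j - 1) leaves the exponent 2^j +
          1.\<close>
        have "\<alpha> h ^ (2 ^ j - 1) * \<alpha> h ^ Suc (2 ^ j) = (\<alpha> h ^ 2) ^ 2 ^ j"
          unfolding power_add[symmetric] power_mult[symmetric]
          by (rule arg_cong[where f = "(^) (\<alpha> h)"]) simp
        also have "\<dots> \<le> \<alpha> h ^ (2 ^ j - 1) * \<alpha> ((L ^^ 2 ^ j) h)"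
          using \<alpha>.symmetric_op_power[OF L h(1), of j] \<alpha>.selfadjoint_power[OF h] by (simp add: L_def)
        finally have "\<alpha> h ^ Suc (2 ^ j) \<le> \<alpha> ((L ^^ 2 ^ j) h)"
          using a by simp
        also have "(L ^^ 2 ^ j) h = (L ^^ (2 ^ j - 1)) h \<circ> h"
          using L_Suc[of "2 ^ j - 1"] by simp
        also have "\<alpha> \<dots> \<le> C * \<beta> ((L ^^ (2 ^ j - 1)) h)"
          by (rule C[OF powA])
        also have "\<dots> \<le> \<bar>C\<bar> * \<beta> ((L ^^ (2 ^ j - 1)) h)"
          using powA by (intro mult_right_mono) auto
        also have "\<dots> \<le> \<bar>C\<bar> * \<beta> h ^ 2 ^ j"
          using pow_le[of "2 ^ j - 1"] by (intro mult_left_mono) auto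
        finally show "\<alpha> h ^ Suc (2 ^ j) \<le> \<bar>C\<bar> * \<beta> h ^ 2 ^ j" .
      qed (use h in auto)
    qed (use h in simp)
  qed
  \<comment> \<open>The C*-identities of both seminorms reduce T to the self-adjoint
    \<open>T \<circ> adj T\<close>.\<close>
  have "(\<alpha> T)\<^sup>2 \<le> (\<beta> T)\<^sup>2"
    using selfadjoint[of "T \<circ> adj T"] \<alpha>.cstar[OF T] \<beta>.cstar[OF T] T
    by (simp add: E0_comp adj_closed E0.star_mul adj_adj)
  then show ?thesis
    using T by (simp add: power2_le_iff_abs_le)
qed

section \<open>The operator seminorm\<close>

lemma tring_SN_D:
  assumes "\<gamma> \<in> tring_SN scale tp"
  shows tring_SN_nonneg: "0 \<le> \<gamma> x"
    and tring_SN_triangle: "\<gamma> (x + y) \<le> \<gamma> x + \<gamma> y"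
    and tring_SN_scale: "\<gamma> (scale c x) = cmod c * \<gamma> x"
    and tring_SN_tp: "\<gamma> (tp x y z) \<le> \<gamma> x * \<gamma> y * \<gamma> z"
    and tring_SN_cube: "\<gamma> (tp x x x) = \<gamma> x ^ 3"
  using assms by (auto simp: tring_SN_def)

text \<open>The condition \<open>0 \<le> K\<close> keeps the set bounded below when \<gamma>
  vanishes, since every real K then satisfies the estimate.\<close>

definition op_seminorm :: "('e \<Rightarrow> real) \<Rightarrow> ('e \<Rightarrow> 'e) \<Rightarrow> real" where
  "op_seminorm \<gamma> T = Inf {K. 0 \<le> K \<and> (\<forall>x. \<gamma> (T x) \<le> K * \<gamma> x)}"

lemma op_seminorm_le:
  assumes "0 \<le> K" "\<And>x. \<gamma> (T x) \<le> K * \<gamma> x"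
  shows "op_seminorm \<gamma> T \<le> K"
  unfolding op_seminorm_def using assms by (intro cInf_lower bdd_belowI[of _ 0]) auto

lemma E0_bounded:
  assumes \<gamma>: "\<gamma> \<in> tring_SN scale tp" and T: "T \<in> E0"
  shows "\<exists>K\<ge>0. \<forall>x. \<gamma> (T x) \<le> K * \<gamma> x"
  using T
proof (induction rule: E0_induct)
  case zero
  have "\<gamma> 0 = 0" using tring_SN_scale[OF \<gamma>, of 0 0] by simp
  then show ?case by (intro exI[of _ 0]) simp
next
  case (step c y z S)
  then obtain K where K: "0 \<le> K" "\<And>x. \<gamma> (S x) \<le> K * \<gamma> x" by blast
  have "\<gamma> ((op_scale scale c (inner y z) + S) x) \<le> (cmod c * (\<gamma> y * \<gamma> z) + K) * \<gamma> x" for x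
  proof -
    have "\<gamma> ((op_scale scale c (inner y z) + S) x) \<le> cmod c * \<gamma> (tp x y z) + \<gamma> (S x)"
      using tring_SN_triangle[OF \<gamma>, of "scale c (tp x y z)" "S x"]
      by (simp add: op_scale_def r_inner_def tring_SN_scale[OF \<gamma>])
    also have "\<dots> \<le> cmod c * (\<gamma> x * \<gamma> y * \<gamma> z) + K * \<gamma> x"
      by (intro add_mono mult_left_mono tring_SN_tp[OF \<gamma>] K) auto
    finally show ?thesis by (simp add: algebra_simps)
  qed
  moreover have "0 \<le> cmod c * (\<gamma> y * \<gamma> z) + K"
    using K(1) by (simp add: tring_SN_nonneg[OF \<gamma>])
  ultimately show "\<exists>K\<ge>0. \<forall>x. \<gamma> ((op_scale scale c (inner y z) + S) x) \<le> K * \<gamma> x" by blast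
qed

lemma
  assumes \<gamma>: "\<gamma> \<in> tring_SN scale tp" and T: "T \<in> E0"
  shows op_seminorm_nonneg: "0 \<le> op_seminorm \<gamma> T"
    and op_seminorm_apply: "\<gamma> (T x) \<le> op_seminorm \<gamma> T * \<gamma> x"
proof -
  let ?W = "{K. 0 \<le> K \<and> (\<forall>x. \<gamma> (T x) \<le> K * \<gamma> x)}"
  obtain K where K: "K \<in> ?W" using E0_bounded[OF assms] by blast
  then show "0 \<le> op_seminorm \<gamma> T"
    unfolding op_seminorm_def by (intro cInf_greatest) auto
  show "\<gamma> (T x) \<le> op_seminorm \<gamma> T * \<gamma> x"
  proof (cases "\<gamma> x = 0")
    case True
    from K have "\<gamma> (T x) \<le> K * \<gamma> x" by blast
    with True show ?thesis by simp
  next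
    case False
    then have pos: "0 < \<gamma> x" using tring_SN_nonneg[OF \<gamma>, of x] by linarith
    have "\<gamma> (T x) / \<gamma> x \<le> op_seminorm \<gamma> T"
      unfolding op_seminorm_def
    proof (rule cInf_greatest)
      show "?W \<noteq> {}" using K by blast
    qed (use pos in \<open>auto simp: field_simps\<close>)
    with pos show ?thesis by (simp add: field_simps)
  qed
qed

lemma op_seminorm_comp:
  assumes \<gamma>: "\<gamma> \<in> tring_SN scale tp" and S: "S \<in> E0" and T: "T \<in> E0"
  shows "op_seminorm \<gamma> (T \<circ> S) \<le> op_seminorm \<gamma> S * op_seminorm \<gamma> T"
proof (rule op_seminorm_le)
  show "\<gamma> ((T \<circ> S) x) \<le> op_seminorm \<gamma> S * op_seminorm \<gamma> T * \<gamma> x" for x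
    using order_trans[OF op_seminorm_apply[OF \<gamma> T, of "S x"]
        mult_left_mono[OF op_seminorm_apply[OF \<gamma> S, of x] op_seminorm_nonneg[OF \<gamma> T]]]
    by (simp add: mult_ac)
qed (simp add: op_seminorm_nonneg[OF \<gamma>] S T)

text \<open>The cube identity at T x, with one T moved across: (T x, T x, T x) = (adj T (T x), x, T
  x). One factor \<gamma>(T x) then cancels.\<close>

lemma op_seminorm_sq_le:
  assumes \<gamma>: "\<gamma> \<in> tring_SN scale tp" and T: "T \<in> E0"
  shows "(op_seminorm \<gamma> T)\<^sup>2 \<le> op_seminorm \<gamma> (adj T \<circ> T)"
proof -
  let ?K = "op_seminorm \<gamma> (adj T \<circ> T)"
  note nn = tring_SN_nonneg[OF \<gamma>]
  have A: "adj T \<circ> T \<in> E0" using T by (simp add: E0_comp adj_closed)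
  have "op_seminorm \<gamma> T \<le> sqrt ?K"
  proof (rule op_seminorm_le)
    fix x
    have "(\<gamma> (T x))\<^sup>2 \<le> ?K * (\<gamma> x)\<^sup>2"
    proof (cases "\<gamma> (T x) = 0")
      case False
      have "\<gamma> (T x) ^ 3 = \<gamma> (tp (adj T (T x)) x (T x))"
        using tp_adj[of "adj T" "T x" x "T x"] tring_SN_cube[OF \<gamma>, of "T x"] T
        by (simp add: adj_closed adj_adj)
      also have "\<dots> \<le> \<gamma> (adj T (T x)) * \<gamma> x * \<gamma> (T x)"
        by (rule tring_SN_tp[OF \<gamma>])
      also have "\<dots> \<le> (?K * \<gamma> x) * \<gamma> x * \<gamma> (T x)"
        using op_seminorm_apply[OF \<gamma> A, of x] nn by (intro mult_right_mono) auto
      finally have "(\<gamma> (T x))\<^sup>2 * \<gamma> (T x) \<le> (?K * (\<gamma> x)\<^sup>2) * \<gamma> (T x)"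
        by (simp add: power3_eq_cube power2_eq_square mult_ac)
      with False nn[of "T x"] show ?thesis by simp
    qed (simp add: op_seminorm_nonneg[OF \<gamma> A])
    then have "\<gamma> (T x) \<le> sqrt (?K * (\<gamma> x)\<^sup>2)" by (rule real_le_rsqrt)
    then show "\<gamma> (T x) \<le> sqrt ?K * \<gamma> x" by (simp add: real_sqrt_mult nn)
  qed (simp add: op_seminorm_nonneg[OF \<gamma> A])
  then have "(op_seminorm \<gamma> T)\<^sup>2 \<le> (sqrt ?K)\<^sup>2"
    using op_seminorm_nonneg[OF \<gamma> T] by (rule power_mono)
  then show ?thesis using op_seminorm_nonneg[OF \<gamma> A] by simp
qed

text \<open>In the reversed product \<open>op_seminorm_sq_le\<close> concerns T T*. It first shows
  that the involution is isometric and then, used for \<open>adj T\<close>, gives the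
  C*-identity.\<close>

lemma op_seminorm_cstar:
  assumes \<gamma>: "\<gamma> \<in> tring_SN scale tp" and T: "T \<in> E0"
  shows "op_seminorm \<gamma> (T \<circ> adj T) = (op_seminorm \<gamma> T)\<^sup>2"
proof -
  have le: "op_seminorm \<gamma> S \<le> op_seminorm \<gamma> (adj S)" if S: "S \<in> E0" for S
  proof (cases "op_seminorm \<gamma> S = 0")
    case False
    have "op_seminorm \<gamma> S * op_seminorm \<gamma> S \<le> op_seminorm \<gamma> S * op_seminorm \<gamma> (adj S)"
      using op_seminorm_sq_le[OF \<gamma> S] op_seminorm_comp[OF \<gamma> S adj_closed[OF S]]
      by (simp add: power2_eq_square)
    with False op_seminorm_nonneg[OF \<gamma> S] show ?thesis by simp
  qed (simp add: op_seminorm_nonneg[OF \<gamma>] adj_closed S)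
  have eq: "op_seminorm \<gamma> (adj T) = op_seminorm \<gamma> T"
    using le[OF T] le[OF adj_closed[OF T]] by (simp add: adj_adj T)
  show ?thesis
    using op_seminorm_sq_le[OF \<gamma> adj_closed[OF T]] op_seminorm_comp[OF \<gamma> adj_closed[OF T] T]
    by (simp add: adj_adj T eq power2_eq_square)
qed

lemma op_seminorm_scale:
  assumes \<gamma>: "\<gamma> \<in> tring_SN scale tp" and T: "T \<in> E0"
  shows "op_seminorm \<gamma> (op_scale scale c T) = cmod c * op_seminorm \<gamma> T"
proof (rule antisym)
  have le: "op_seminorm \<gamma> (op_scale scale k S) \<le> cmod k * op_seminorm \<gamma> S" if "S \<in> E0" for k S
    using that mult_left_mono[OF op_seminorm_apply[OF \<gamma> that], of "cmod k"]
    by (intro op_seminorm_le)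
      (simp_all add: op_seminorm_nonneg[OF \<gamma>] op_scale_def tring_SN_scale[OF \<gamma>] mult.assoc)
  show "op_seminorm \<gamma> (op_scale scale c T) \<le> cmod c * op_seminorm \<gamma> T"
    by (rule le[OF T])
  show "cmod c * op_seminorm \<gamma> T \<le> op_seminorm \<gamma> (op_scale scale c T)"
  proof (cases "c = 0")
    case False
    have "op_scale scale (inverse c) (op_scale scale c T) = T"
      using False by (simp add: op_scale_def)
    then show ?thesis
      using le[OF E0_scale[OF T, of c], of "inverse c"] False
      by (simp add: norm_inverse norm_divide field_simps)
  qed (simp add: op_seminorm_nonneg[OF \<gamma>] E0_scale[OF T])
qed

lemma op_seminorm_in_SN:
  assumes \<gamma>: "\<gamma> \<in> tring_SN scale tp"
  shows "restrict (op_seminorm \<gamma>) E0 \<in> alg_SN (E0r scale tp)"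
proof -
  have "op_seminorm \<gamma> (S + T) \<le> op_seminorm \<gamma> S + op_seminorm \<gamma> T" if "S \<in> E0" "T \<in> E0" for S T
  proof (rule op_seminorm_le)
    show "\<gamma> ((S + T) x) \<le> (op_seminorm \<gamma> S + op_seminorm \<gamma> T) * \<gamma> x" for x
      using tring_SN_triangle[OF \<gamma>, of "S x" "T x"] op_seminorm_apply[OF \<gamma> that(1), of x]
        op_seminorm_apply[OF \<gamma> that(2), of x] by (simp add: distrib_right)
  qed (simp add: op_seminorm_nonneg[OF \<gamma>] that)
  then have "restrict (op_seminorm \<gamma>) E0 \<in> alg_SN E0.alg"
    unfolding alg_SN_def
    by (simp add: E0.alg_def op_seminorm_nonneg[OF \<gamma>] E0_add E0_scale E0_comp adj_closed
        op_seminorm_scale[OF \<gamma>] op_seminorm_comp[OF \<gamma>] op_seminorm_cstar[OF \<gamma>])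
  then show ?thesis by (simp only: E0_alg)
qed

text \<open>The lower bound tests <x, x> on x itself, where the value (x, x, x) has seminorm
  \<gamma>(x)^3.\<close>

lemma op_seminorm_inner:
  assumes \<gamma>: "\<gamma> \<in> tring_SN scale tp"
  shows "op_seminorm \<gamma> (inner x x) = (\<gamma> x)\<^sup>2"
proof (rule antisym)
  show "op_seminorm \<gamma> (inner x x) \<le> (\<gamma> x)\<^sup>2"
  proof (rule op_seminorm_le)
    show "\<gamma> (inner x x u) \<le> (\<gamma> x)\<^sup>2 * \<gamma> u" for u
      using tring_SN_tp[OF \<gamma>, of u x x] by (simp add: r_inner_def power2_eq_square mult_ac)
  qed simp
  show "(\<gamma> x)\<^sup>2 \<le> op_seminorm \<gamma> (inner x x)"
  proof (cases "\<gamma> x = 0")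
    case False
    have "(\<gamma> x)\<^sup>2 * \<gamma> x \<le> op_seminorm \<gamma> (inner x x) * \<gamma> x"
      using op_seminorm_apply[OF \<gamma> E0_inner, of x x x] tring_SN_cube[OF \<gamma>, of x]
      by (simp add: r_inner_def power3_eq_cube power2_eq_square)
    with False tring_SN_nonneg[OF \<gamma>, of x] show ?thesis by simp
  qed (simp add: op_seminorm_nonneg[OF \<gamma>])
qed

lemma tring_seminorm_op_seminorm:
  assumes "\<gamma> \<in> tring_SN scale tp"
  shows "tring_seminorm (restrict (op_seminorm \<gamma>) E0) = \<gamma>"
  by (rule ext) (simp add: tring_seminorm_def op_seminorm_inner[OF assms] tring_SN_nonneg[OF assms])

section \<open>Norms and the order isomorphisms\<close>

text \<open>If \<alpha>(T) = 0, the module estimate gives \<gamma>_\<alpha>(T x) = 0 for all x, so T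
  = 0 when \<gamma>_\<alpha> is a norm. Conversely, <x, x> = 0 forces (x, x, x) = 0, and
  admissibility applies.\<close>

lemma tring_seminorm_in_N_iff:
  assumes \<alpha>_SN: "\<alpha> \<in> alg_SN (E0r scale tp)" and pos: "right_positive scale tp"
  shows "tring_seminorm \<alpha> \<in> tring_N scale tp \<longleftrightarrow> \<alpha> \<in> alg_N (E0r scale tp)"
proof
  interpret cstar_seminormed "op_scale scale" E0 "\<lambda>S T. T \<circ> S" adj \<alpha>
    by (rule cstar_seminormed_E0[OF \<alpha>_SN])
  have zero_eq: "alg_zero (E0r scale tp) = 0" by (simp add: E0r_def)
  show "\<alpha> \<in> alg_N (E0r scale tp)" if N: "tring_seminorm \<alpha> \<in> tring_N scale tp"
  proof -
    have "T = 0" if T: "T \<in> E0" "\<alpha> T = 0" for T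
    proof
      fix x
      have "tring_seminorm \<alpha> (T x) \<le> 0"
        using tring_seminorm_apply_le[OF \<alpha>_SN T(1), of x] T(2) by simp
      then have "tring_seminorm \<alpha> (T x) = 0"
        using tring_seminorm_nonneg[OF \<alpha>_SN, of "T x"] by linarith
      then show "T x = 0 x" using N by (simp add: tring_N_def)
    qed
    then show ?thesis using \<alpha>_SN by (simp add: alg_N_def zero_eq)
  qed
  show "tring_seminorm \<alpha> \<in> tring_N scale tp" if N: "\<alpha> \<in> alg_N (E0r scale tp)"
  proof -
    have "x = 0" if "tring_seminorm \<alpha> x = 0" for x
    proof -
      have "inner x x = 0"
        using that N by (simp add: tring_seminorm_def alg_N_def zero_eq)
      then show ?thesis
        using admissible[of x] by (simp add: r_inner_def fun_eq_iff)
    qed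
    then show ?thesis
      using tring_seminorm_in_SN[OF \<alpha>_SN pos] by (simp add: tring_N_def)
  qed
qed

lemma tring_seminorm_le_iff:
  assumes "right_positive scale tp" "\<alpha> \<in> alg_SN (E0r scale tp)" "\<beta> \<in> alg_SN (E0r scale tp)"
  shows "tring_seminorm \<alpha> \<le> tring_seminorm \<beta> \<longleftrightarrow> \<alpha> \<le> \<beta>"
proof
  assume le: "tring_seminorm \<alpha> \<le> tring_seminorm \<beta>"
  show "\<alpha> \<le> \<beta>"
  proof (rule le_funI)
    fix T
    show "\<alpha> T \<le> \<beta> T"
    proof (cases "T \<in> E0")
      case True
      then show ?thesis
        using tring_seminorm_reflects_le[OF assms(2,3,1) le_funD[OF le]] by blast
    next
      \<comment> \<open>Off the carrier both functions are \<open>undefined\<close>, by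
        extensionality.\<close>
      case False
      then show ?thesis
        using assms(2,3) by (simp add: alg_SN_def extensional_def)
    qed
  qed
qed (auto simp: le_fun_def tring_seminorm_def)

text \<open>Order reflection in both directions gives injectivity; the operator seminorm gives
  surjectivity.\<close>

lemma tring_seminorm_bij:
  assumes "right_positive scale tp"
  shows "bij_betw tring_seminorm (alg_SN (E0r scale tp)) (tring_SN scale tp)"
  unfolding bij_betw_def
proof
  show "inj_on tring_seminorm (alg_SN (E0r scale tp))"
    by (rule inj_onI) (metis antisym tring_seminorm_le_iff[OF assms] order_refl)
  show "tring_seminorm ` alg_SN (E0r scale tp) = tring_SN scale tp"
  proof
    show "tring_seminorm ` alg_SN (E0r scale tp) \<subseteq> tring_SN scale tp"
      using tring_seminorm_in_SN[OF _ assms] by blast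
    show "tring_SN scale tp \<subseteq> tring_seminorm ` alg_SN (E0r scale tp)"
      using tring_seminorm_op_seminorm op_seminorm_in_SN by (metis image_eqI subsetI)
  qed
qed

end

text \<open>The explicit map runs from the algebra side to the ring side, against the direction of
  the claim.\<close>

lemma order_isomorphicI:
  assumes "bij_betw g Y X" "\<And>y y'. y \<in> Y \<Longrightarrow> y' \<in> Y \<Longrightarrow> g y \<le> g y' \<longleftrightarrow> y \<le> y'"
  shows "order_isomorphic X Y"
  unfolding order_isomorphic_def
proof (intro exI conjI ballI)
  show "bij_betw (inv_into Y g) X Y"
    by (rule bij_betw_inv_into[OF assms(1)])
  show "x \<le> x' \<longleftrightarrow> inv_into Y g x \<le> inv_into Y g x'" if "x \<in> X" "x' \<in> X" for x x'
    using assms(2)[of "inv_into Y g x" "inv_into Y g x'"] that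
      bij_betw_inv_into_right[OF assms(1)] bij_betwE[OF bij_betw_inv_into[OF assms(1)]] by simp
qed

theorem corollary3p31:
  fixes scale :: "complex \<Rightarrow> 'e::ab_group_add \<Rightarrow> 'e"
    and tp :: "'e \<Rightarrow> 'e \<Rightarrow> 'e \<Rightarrow> 'e"
  assumes "admissible_star_tring scale tp"
    and "right_positive scale tp"
  shows "E0r_SN_cs scale tp = alg_SN (E0r scale tp) \<and>
    order_isomorphic (tring_SN scale tp) (alg_SN (E0r scale tp)) \<and>
    order_isomorphic (tring_N scale tp) (alg_N (E0r scale tp))"
proof -
  interpret admissible_star_tring scale tp by fact
  note pos = assms(2)
  note bij = tring_seminorm_bij[OF pos]
  have "E0r_SN_cs scale tp = alg_SN (E0r scale tp)"
    using inner_cauchy_schwarz[OF _ pos] by (auto simp: E0r_SN_cs_def)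
  moreover have "order_isomorphic (tring_SN scale tp) (alg_SN (E0r scale tp))"
    by (rule order_isomorphicI[OF bij tring_seminorm_le_iff[OF pos]])
  moreover have "order_isomorphic (tring_N scale tp) (alg_N (E0r scale tp))"
  proof (rule order_isomorphicI)
    have sub: "alg_N (E0r scale tp) \<subseteq> alg_SN (E0r scale tp)" "tring_N scale tp \<subseteq> tring_SN scale tp"
      by (auto simp: alg_N_def tring_N_def)
    have "tring_seminorm ` alg_N (E0r scale tp) = tring_N scale tp"
    proof
      show "tring_seminorm ` alg_N (E0r scale tp) \<subseteq> tring_N scale tp"
        using tring_seminorm_in_N_iff[OF _ pos] sub by blast
      show "tring_N scale tp \<subseteq> tring_seminorm ` alg_N (E0r scale tp)"
      proof
        fix \<gamma> assume \<gamma>: "\<gamma> \<in> tring_N scale tp"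
        with sub(2) obtain \<alpha> where "\<alpha> \<in> alg_SN (E0r scale tp)" "\<gamma> = tring_seminorm \<alpha>"
          using bij_betw_imp_surj_on[OF bij] by (metis imageE subsetD)
        with \<gamma> show "\<gamma> \<in> tring_seminorm ` alg_N (E0r scale tp)"
          using tring_seminorm_in_N_iff[OF _ pos, of \<alpha>] by simp
      qed
    qed
    then show "bij_betw tring_seminorm (alg_N (E0r scale tp)) (tring_N scale tp)"
      using bij sub(1) by (metis bij_betw_subset)
    show "tring_seminorm \<alpha> \<le> tring_seminorm \<beta> \<longleftrightarrow> \<alpha> \<le> \<beta>"
      if "\<alpha> \<in> alg_N (E0r scale tp)" "\<beta> \<in> alg_N (E0r scale tp)" for \<alpha> \<beta>
      using that sub(1) by (simp add: tring_seminorm_le_iff[OF pos] subsetD)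
  qed
  ultimately show ?thesis by blast
qed

end
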